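(* For a real number $x\in\mathbb{R}$, the following statements are equivalent: (i) $x$ is a Markov fraction. (ii) The vertical geodesic $g_x$ joining $x$ and $\infty$ in $H^2$ projects to a simple geodesic $\pi(g_x)$ in the modular torus $M$ with both ends in the cusp.
   Context: A Markov triple is a triple $(q_1,q_2,q_3)$ of positive integers with $q_1^2+q_2^2+q_3^2=3q_1q_2q_3$. A triple of rational numbers $(x_1,x_2,x_3)$ is a rational Markov triple if $x_k=\frac{p_k}{q_k}$ for some Markov triple $(q_1,q_2,q_3)$ and some integers $p_1,p_2,p_3$ satisfying $p_2q_1-p_1q_2=q_3$ and $p_3q_2-p_2q_3=q_1$. A Markov fraction is an element of some rational Markov triple. Let $H^2=\{z\in\mathbb{C}\mid \operatorname{Im} z>0\}$ with metric $|dz|/\operatorname{Im} z$ be the hyperbolic plane, with ideal boundary $\mathbb{R}\cup\{\infty\}$. Let $G<PSL_2(\mathbb{Z})$ be the commutator subgroup of $PSL_2(\mathbb{Z})$, acting by Möbius transformations; it is freely generated by the classes of $\begin{pmatrix}1&-1\\-1&2\end{pmatrix}$ and $\begin{pmatrix}1&1\\1&2\end{pmatrix}$. The modular torus is the once-punctured hyperbolic torus $M=G\backslash H^2$, with projection $\pi:H^2\to M$. A geodesic is simple if it has no self-intersections. A geodesic in $M$ has both ends in the cusp if its lifts to $H^2$ have both ideal endpoints in $\mathbb{Q}\cup\{\infty\}$. *)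

theory Defs
  imports "HOL-Analysis.Analysis" "HOL-Algebra.Generated_Groups"
begin

subsection \<open>Markov fractions\<close>

definition markov_triple :: "int \<Rightarrow> int \<Rightarrow> int \<Rightarrow> bool" where
  "markov_triple q1 q2 q3 \<longleftrightarrow>
     q1 > 0 \<and> q2 > 0 \<and> q3 > 0 \<and> q1\<^sup>2 + q2\<^sup>2 + q3\<^sup>2 = 3 * q1 * q2 * q3"

definition rational_markov_triple :: "real \<Rightarrow> real \<Rightarrow> real \<Rightarrow> bool" where
  "rational_markov_triple x1 x2 x3 \<longleftrightarrow>
     (\<exists>q1 q2 q3 p1 p2 p3 :: int. markov_triple q1 q2 q3 \<and>
        x1 = of_int p1 / of_int q1 \<and> x2 = of_int p2 / of_int q2 \<and> x3 = of_int p3 / of_int q3 \<and>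
        p2 * q1 - p1 * q2 = q3 \<and> p3 * q2 - p2 * q3 = q1)"

definition markov_fraction :: "real \<Rightarrow> bool" where
  "markov_fraction x \<longleftrightarrow>
     (\<exists>x1 x2 x3. rational_markov_triple x1 x2 x3 \<and> x \<in> {x1, x2, x3})"


subsection \<open>The hyperbolic plane\<close>

definition H2 :: "complex set" where
  "H2 = {z. Im z > 0}"

text \<open>
  The length of a path with respect to the metric \<open>|dz| / Im z\<close>. It is a relation because piecewise
  \<open>C\<^sup>1\<close> paths in the sense of the library may have unbounded derivative near a breakpoint, hence
  infinite length; such a path has no length here (\<open>integral\<close> would give it length 0).
\<close>

definition has_hyp_length :: "(real \<Rightarrow> complex) \<Rightarrow> real \<Rightarrow> bool" where
  "has_hyp_length p L \<longleftrightarrow>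
     ((\<lambda>t. norm (vector_derivative p (at t)) / Im (p t)) has_integral L) {0..1}"

definition hyp_dist :: "complex \<Rightarrow> complex \<Rightarrow> real" where
  "hyp_dist z w = Inf {L. \<exists>p. valid_path p \<and> path_image p \<subseteq> H2 \<and>
     pathstart p = z \<and> pathfinish p = w \<and> has_hyp_length p L}"

text \<open>Complete geodesics, parametrised by arc length: locally isometric maps from the real line.\<close>

definition hyp_geodesic :: "(real \<Rightarrow> complex) \<Rightarrow> bool" where
  "hyp_geodesic \<gamma> \<longleftrightarrow> range \<gamma> \<subseteq> H2 \<and>
     (\<forall>t. \<exists>e>0. \<forall>s\<in>ball t e. \<forall>s'\<in>ball t e. hyp_dist (\<gamma> s) (\<gamma> s') = \<bar>s - s'\<bar>)"

text \<open>
  The vertical geodesic joining \<open>x\<close> (at time \<open>-\<infinity>\<close>) and \<open>\<infinity>\<close> (at time \<open>+\<infinity>\<close>). The exponential makes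
  the parametrisation one by arc length.
\<close>

definition vertical_geodesic :: "real \<Rightarrow> real \<Rightarrow> complex" where
  "vertical_geodesic x t = Complex x (exp t)"

text \<open>
  Convergence, along the filter \<open>F\<close>, to a point of \<open>\<rat> \<union> {\<infinity>}\<close> in the ideal boundary \<open>\<real> \<union> {\<infinity>}\<close>.
\<close>

definition tends_to_cusp :: "(real \<Rightarrow> complex) \<Rightarrow> real filter \<Rightarrow> bool" where
  "tends_to_cusp \<gamma> F \<longleftrightarrow>
     (\<exists>q\<in>\<rat>. (\<gamma> \<longlongrightarrow> complex_of_real q) F) \<or> filterlim \<gamma> at_infinity F"


subsection \<open>The modular torus\<close>

definition SL2Z :: "(int^2^2) monoid" where
  "SL2Z = \<lparr>carrier = {A. det A = 1}, mult = (**), one = mat 1\<rparr>"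

definition PSL2Z :: "(int^2^2) set monoid" where
  "PSL2Z = SL2Z Mod {mat 1, - mat 1}"

definition commutator_PSL2Z :: "(int^2^2) set set" where
  "commutator_PSL2Z = derived PSL2Z (carrier PSL2Z)"

definition moebius :: "int^2^2 \<Rightarrow> complex \<Rightarrow> complex" where
  "moebius A z = (of_int (A$1$1) * z + of_int (A$1$2)) / (of_int (A$2$1) * z + of_int (A$2$2))"

text \<open>
  Elements of \<^const>\<open>PSL2Z\<close> are cosets \<open>{A, -A}\<close>; both representatives induce the same transformation.
\<close>

definition orbit_rel :: "(complex \<times> complex) set" where
  "orbit_rel = {(z, w). z \<in> H2 \<and> (\<exists>C\<in>commutator_PSL2Z. \<exists>A\<in>C. w = moebius A z)}"

definition modular_torus :: "complex set set" where
  "modular_torus = H2 // orbit_rel"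

definition torus_proj :: "complex \<Rightarrow> complex set" where
  "torus_proj z = orbit_rel `` {z}"

text \<open>
  The covering \<^const>\<open>torus_proj\<close> from \<^const>\<open>H2\<close> onto \<^const>\<open>modular_torus\<close> is a local isometry, so
  the geodesics of the torus are the projections of those of the hyperbolic plane.
\<close>

definition torus_geodesic :: "(real \<Rightarrow> complex set) \<Rightarrow> bool" where
  "torus_geodesic c \<longleftrightarrow> (\<exists>\<gamma>. hyp_geodesic \<gamma> \<and> c = torus_proj \<circ> \<gamma>)"

text \<open>
  A geodesic has no self-intersections if it passes through a point at two different times only by
  being periodic and running through the same curve again; thus it is either injective or a
  simple closed geodesic.
\<close>

definition simple_torus_geodesic :: "(real \<Rightarrow> complex set) \<Rightarrow> bool" where
  "simple_torus_geodesic c \<longleftrightarrow> torus_geodesic c \<and>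
     (\<forall>s t. c s = c t \<longrightarrow> (\<forall>u. c (s + u) = c (t + u)))"

definition is_lift :: "(real \<Rightarrow> complex) \<Rightarrow> (real \<Rightarrow> complex set) \<Rightarrow> bool" where
  "is_lift \<gamma> c \<longleftrightarrow> continuous_on UNIV \<gamma> \<and> range \<gamma> \<subseteq> H2 \<and> torus_proj \<circ> \<gamma> = c"

definition both_ends_in_cusp :: "(real \<Rightarrow> complex set) \<Rightarrow> bool" where
  "both_ends_in_cusp c \<longleftrightarrow>
     (\<forall>\<gamma>. is_lift \<gamma> c \<longrightarrow> tends_to_cusp \<gamma> at_bot \<and> tends_to_cusp \<gamma> at_top)"

end

theory Submission
  imports Defs
begin

text \<open>
  The geodesic above \<open>x\<close> has both ends in the cusp if and only if \<open>x\<close> is rational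
  (\<open>both_ends_in_cusp_vertical\<close>), and it is simple if and only if no element of the commutator subgroup
  other than \<open>\<plusminus>1\<close> carries one of its points to a point of it (\<open>simple_vertical_iff\<close>). An element
  \<open>A\<close> does so if and only if \<open>A \<infinity>\<close> and \<open>A x\<close> are separated by the geodesic, or both lie
  among its endpoints (\<open>moebius_vertical_iff\<close>). The problem becomes arithmetic because the
  commutator subgroup is the kernel of an explicit character of order 6 (\<open>Union_commutator\<close>).
  The character also shows that the subgroup acts freely, which makes lifts of curves unique up to
  its elements; so every lift is the image of the vertical geodesic under one matrix.

  A rational Markov triple \<open>(x1, x2, x3)\<close> describes a triangulation of the torus by ideal
  triangles. Its three edges carry half-turns, which exchange \<open>\<infinity>\<close> with \<open>x1\<close>, \<open>x2\<close>
  and \<open>x3\<close>. They generate a group that contains the commutator subgroup: this is checked for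
  three consecutive integers, and it is preserved by flips, which connect every triple with an integral
  one by Markov's descent (\<open>rational_triple_generating\<close>). The half-turns play ping-pong on the
  three boundary arcs cut out by the ideal triangle with vertices \<open>\<infinity>, x1, x3\<close>. Hence every
  nontrivial element maps both endpoints of an edge of the triangle into one of the three closed arcs, and the
  image does not cross the edge. It could only be the edge itself, traversed backwards, but then the
  element is a half-turn and not in the commutator subgroup. So Markov fractions give simple geodesics.

  Conversely, a Markov fraction \<open>x1\<close> forbids simple geodesics nearby. There is a hyperbolic element
  of the commutator subgroup that carries \<open>\<infinity>\<close> to \<open>x1\<close>, with fixed points on the same side of
  \<open>x1\<close>, and a vertical geodesic that ends between \<open>x1\<close> and the nearer fixed point crosses its
  own image (\<open>simple_avoids_neighbourhood\<close>). Every rational \<open>x\<close> that is not an integer lies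
  between two consecutive integers, and the flips of triples subdivide intervals between neighbouring
  Markov fractions. As long as \<open>x\<close> is not reached, it lies in one of the subintervals. If \<open>x\<close> has
  denominator \<open>q\<close> and avoids the forbidden neighbourhoods, then the denominator of the new endpoint
  is less than \<open>q\<^sup>2\<close>. These denominators increase, so the search ends
  (\<open>simple_between_is_markov\<close>).
\<close>

section \<open>Integer matrices of size two\<close>

definition mx :: "int \<Rightarrow> int \<Rightarrow> int \<Rightarrow> int \<Rightarrow> int^2^2" where
  "mx a b c d = vector [vector [a, b], vector [c, d]]"

lemma mx_nth [simp]:
  "mx a b c d $ 1 $ 1 = a" "mx a b c d $ 1 $ 2 = b" "mx a b c d $ 2 $ 1 = c" "mx a b c d $ 2 $ 2 = d"
  by (simp_all add: mx_def)

lemma mx_collapse: "mx (A$1$1) (A$1$2) (A$2$1) (A$2$2) = A"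
  by (simp add: vec_eq_iff forall_2)

lemma mx_cases: obtains a b c d where "A = mx a b c d"
  by (metis mx_collapse)

lemma mx_eq_iff [simp]: "mx a b c d = mx a' b' c' d' \<longleftrightarrow> a = a' \<and> b = b' \<and> c = c' \<and> d = d'"
  by (metis mx_nth)

lemma mx_mult [simp]:
  "mx a b c d ** mx a' b' c' d' = mx (a*a' + b*c') (a*b' + b*d') (c*a' + d*c') (c*b' + d*d')"
  by (simp add: vec_eq_iff forall_2 matrix_matrix_mult_def sum_2)

lemma mx_uminus [simp]: "- mx a b c d = mx (-a) (-b) (-c) (-d)"
  by (simp add: vec_eq_iff forall_2)

lemma mx_one: "mat 1 = mx 1 0 0 1"
  by (simp add: vec_eq_iff forall_2 mat_def)

lemma mx_det [simp]: "det (mx a b c d) = a * d - b * c"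
  by (simp add: det_2)

lemma neg_mult_mx [simp]: "(- A) ** B = - (A ** B)" "A ** (- B) = - (A ** B)" for A B :: "int^2^2"
  by (cases A rule: mx_cases, cases B rule: mx_cases, simp)+

lemma det_neg_mx [simp]: "det (- A) = det A" for A :: "int^2^2"
  by (cases A rule: mx_cases) simp

definition adj :: "int^2^2 \<Rightarrow> int^2^2" where
  "adj A = mx (A$2$2) (- A$1$2) (- A$2$1) (A$1$1)"

lemma adj_mx [simp]: "adj (mx a b c d) = mx d (-b) (-c) a"
  by (simp add: adj_def)

lemma adj_inverse:
  assumes "det A = 1" shows "A ** adj A = mat 1" "adj A ** A = mat 1"
  using assms by (cases A rule: mx_cases, simp add: mx_one algebra_simps)+

lemma det_adj [simp]: "det (adj A) = det A"
  by (cases A rule: mx_cases) (simp add: algebra_simps)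

definition tr :: "int^2^2 \<Rightarrow> int" where
  "tr A = A$1$1 + A$2$2"

abbreviation Tpow :: "int \<Rightarrow> int^2^2" where
  "Tpow n \<equiv> mx 1 n 0 1"

abbreviation Smat :: "int^2^2" where
  "Smat \<equiv> mx 0 (-1) 1 0"

text \<open>
  Euclid's algorithm on the lower row: right multiplication by a power of \<open>T\<close> reduces \<open>d\<close> modulo
  \<open>c\<close>, and right multiplication by \<open>S\<close> exchanges the two columns.
\<close>

lemma SL2Z_induct [consumes 1, case_names one T S]:
  fixes A :: "int^2^2"
  assumes "det A = 1"
    and one: "P (mat 1)"
    and T: "\<And>A n. det A = 1 \<Longrightarrow> P A \<Longrightarrow> P (A ** Tpow n)"
    and S: "\<And>A. det A = 1 \<Longrightarrow> P A \<Longrightarrow> P (A ** Smat)"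
  shows "P A"
proof -
  have "P (mx a b c d)" if "a * d - b * c = 1" for a b c d
    using that
  proof (induction "nat \<bar>c\<bar>" arbitrary: a b c d rule: less_induct)
    case less
    show ?case
    proof (cases "c = 0")
      case True
      with less.prems have "a * d = 1" by simp
      then consider "a = 1" "d = 1" | "a = -1" "d = -1"
        by (auto simp: zmult_eq_1_iff)
      then show ?thesis
      proof cases
        case 1
        then show ?thesis using T[OF _ one, of b] True by (simp add: mx_one)
      next
        case 2
        have "P (Smat ** Smat)" using S[OF _ S[OF _ one]] by (simp add: mx_one)
        from T[OF _ this, of "-b"] show ?thesis using 2 True by simp
      qed
    next
      case False
      define n where "n = d div c"
      define r where "r = d mod c"
      have d: "d = n * c + r" by (simp add: n_def r_def)
      have r: "\<bar>r\<bar> < \<bar>c\<bar>" using False by (simp add: r_def abs_mod_less)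
      have 1: "P (mx (b - n * a) (- a) r (- c))"
      proof (rule less.hyps)
        show "nat \<bar>r\<bar> < nat \<bar>c\<bar>" using r by simp
        show "(b - n * a) * - c - - a * r = 1"
          using less.prems by (simp add: d algebra_simps)
      qed
      have det1: "det (mx (b - n * a) (- a) r (- c)) = 1"
        using less.prems by (simp add: d algebra_simps)
      have 2: "P (mx (b - n * a) (- a) r (- c) ** Smat ** Smat ** Smat)"
        by (intro S 1) (simp_all add: det_mul det1 del: mx_mult mx_det, simp_all)
      have "P (mx (b - n * a) (- a) r (- c) ** Smat ** Smat ** Smat ** Tpow n)"
        by (rule T[OF _ 2]) (simp add: det_mul det1 del: mx_mult mx_det, simp)
      then show ?thesis by (simp add: d algebra_simps)
    qed
  qed
  then show ?thesis using \<open>det A = 1\<close> by (cases A rule: mx_cases) simp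
qed

section \<open>The abelianization of the modular group\<close>

text \<open>
  Modulo 6 this polynomial is additive on products of matrices of determinant 1, with value 1 at the
  translation \<open>T\<close> and 3 at \<open>S\<close>, and it does not distinguish \<open>A\<close> from \<open>-A\<close>. It thus induces the isomorphism from the
  abelianization of the modular group to the integers modulo 6. Additivity rests on
  \<open>c\<^sup>3 \<equiv> c\<close> modulo 6.
\<close>

definition chi :: "int^2^2 \<Rightarrow> int" where
  "chi A = (let a = A$1$1; b = A$1$2; c = A$2$1; d = A$2$2 in
     (1 - c\<^sup>2) * (b * d - 3 * d + 3) + c * (a + d - 3))"

lemma chi_mx [simp]: "chi (mx a b c d) = (1 - c\<^sup>2) * (b * d - 3 * d + 3) + c * (a + d - 3)"
  by (simp add: chi_def)

lemma six_dvd_cube: "(6::int) dvd c ^ 3 - c"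
proof -
  define k r where "k = c div 6" and "r = c mod 6"
  have c: "c = 6 * k + r" by (simp add: k_def r_def)
  have "r = 0 \<or> r = 1 \<or> r = 2 \<or> r = 3 \<or> r = 4 \<or> r = 5"
    unfolding r_def by presburger
  then have "6 dvd r ^ 3 - r" by auto
  moreover have "c ^ 3 - c = 6 * (36 * k ^ 3 + 18 * k\<^sup>2 * r + 3 * k * r\<^sup>2 - k) + (r ^ 3 - r)"
    unfolding c by algebra
  ultimately show ?thesis by (metis dvd_add dvd_triv_left)
qed

lemma chi_T: 
  assumes "det A = 1" shows "6 dvd chi (A ** Tpow n) - (chi A + n)"
proof -
  obtain a b c d where A: "A = mx a b c d" by (rule mx_cases)
  have "a * d = 1 + b * c" using assms A by simp
  then have "chi (A ** Tpow n) - (chi A + n) = (c^3 - c) * (- n * (2 * b + n * a - 3))"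
    unfolding A by (simp, algebra)
  then show ?thesis by (metis dvd_mult2 six_dvd_cube)
qed

lemma chi_S:
  assumes "det A = 1" shows "6 dvd chi (A ** Smat) - (chi A + 3)"
proof -
  obtain a b c d where A: "A = mx a b c d" by (rule mx_cases)
  have ad: "a * d = 1 + b * c" using assms A by simp
  have "odd c \<or> odd d"
    using ad by (metis dvd_add_left_iff dvd_mult odd_one)
  then have "2 dvd (1 + c) * (1 + d)" by auto
  moreover have "2 dvd (d\<^sup>2 - d) * c" "2 dvd d\<^sup>2 - d" "2 dvd (c\<^sup>2 - c) * d" "2 dvd c\<^sup>2 - c"
    by auto
  ultimately have "2 dvd (1 + c) * (1 + d) + ((d\<^sup>2 - d) * c + ((d\<^sup>2 - d) + ((c\<^sup>2 - c) * d
      + ((c\<^sup>2 - c) + 2 * (c * d - c\<^sup>2 - c)))))"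
    by (intro dvd_add) simp_all
  then obtain k where k: "(1 + c) * (1 + d) + ((d\<^sup>2 - d) * c + ((d\<^sup>2 - d) + ((c\<^sup>2 - c) * d
      + ((c\<^sup>2 - c) + 2 * (c * d - c\<^sup>2 - c))))) = 2 * k"
    by (elim dvdE)
  have "chi (A ** Smat) - (chi A + 3) = - 3 * ((1 + c) * (1 + d) + ((d\<^sup>2 - d) * c + ((d\<^sup>2 - d)
      + ((c\<^sup>2 - c) * d + ((c\<^sup>2 - c) + 2 * (c * d - c\<^sup>2 - c))))))"
    unfolding A using ad by (simp, algebra)
  also have "\<dots> = 6 * (- k)" unfolding k by simp
  finally show ?thesis by (metis dvd_triv_left)
qed

lemma chi_mult:
  assumes "det A = 1" "det B = 1" shows "6 dvd chi (A ** B) - (chi A + chi B)"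
  using assms(2)
proof (induction B rule: SL2Z_induct)
  case one
  have "chi (mat 1) = 0" by (simp add: mx_one)
  then show ?case by simp
next
  case (T B n)
  have *: "6 dvd chi (A ** B ** Tpow n) - (chi (A ** B) + n)" "6 dvd chi (B ** Tpow n) - (chi B + n)"
    using T.hyps assms(1) by (auto intro!: chi_T simp: det_mul)
  show ?case using dvd_diff[OF dvd_add[OF *(1) T.IH] *(2)] unfolding matrix_mul_assoc
    by (simp add: algebra_simps)
next
  case (S B)
  have *: "6 dvd chi (A ** B ** Smat) - (chi (A ** B) + 3)" "6 dvd chi (B ** Smat) - (chi B + 3)"
    using S.hyps assms(1) by (auto intro!: chi_S simp: det_mul)
  show ?case using dvd_diff[OF dvd_add[OF *(1) S.IH] *(2)] unfolding matrix_mul_assoc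
    by (simp add: algebra_simps)
qed

lemma chi_adj:
  assumes "det A = 1" shows "6 dvd chi (adj A) + chi A"
  using chi_mult[of A "adj A"] assms 
    dvd_minus_iff[of 6 "- chi A - chi (adj A)"] by (simp add: adj_inverse mx_one algebra_simps)

lemma chi_neg:
  assumes "det A = 1" shows "6 dvd chi (- A) - chi A"
proof -
  have "chi (- mat 1) = 6" "det (- mat 1 :: int^2^2) = 1" by (simp_all add: mx_one)
  then have "6 dvd chi (- A) - (chi A + 6)"
    using chi_mult[of A "- mat 1"] assms unfolding neg_mult_mx matrix_mul_rid by simp
  from dvd_add[OF this dvd_refl] show ?thesis by simp
qed

section \<open>The commutator subgroup as a set of matrices\<close>

text \<open>
  The matrices that represent elements of the commutator subgroup, see \<open>Union_commutator\<close>.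
\<close>

definition comm_matrices :: "(int^2^2) set" where
  "comm_matrices = {A. det A = 1 \<and> 6 dvd chi A}"

lemma comm_matrices_one: "mat 1 \<in> comm_matrices"
  by (simp add: comm_matrices_def mx_one)

lemma comm_matrices_mult: "A \<in> comm_matrices \<Longrightarrow> B \<in> comm_matrices \<Longrightarrow> A ** B \<in> comm_matrices"
  using chi_mult[of A B] dvd_add[of 6 "chi A" "chi B"]
  unfolding comm_matrices_def det_mul mem_Collect_eq by (simp add: dvd_diff_left_iff)

lemma comm_matrices_adj: "A \<in> comm_matrices \<Longrightarrow> adj A \<in> comm_matrices"
  using chi_adj[of A] unfolding comm_matrices_def by (simp add: dvd_add_left_iff)

lemma comm_matrices_neg: "A \<in> comm_matrices \<Longrightarrow> - A \<in> comm_matrices"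
  using chi_neg[of A] unfolding comm_matrices_def by (simp add: dvd_diff_left_iff)

definition cls :: "int^2^2 \<Rightarrow> (int^2^2) set" where
  "cls A = {A, - A}"

lemma group_SL2Z: "group SL2Z"
proof (rule groupI)
  fix A assume "A \<in> carrier SL2Z"
  then show "\<exists>B\<in>carrier SL2Z. B \<otimes>\<^bsub>SL2Z\<^esub> A = \<one>\<^bsub>SL2Z\<^esub>"
    by (intro bexI[of _ "adj A"]) (simp_all add: SL2Z_def adj_inverse)
qed (simp_all add: SL2Z_def det_mul matrix_mul_assoc)

interpretation SL2Z: group SL2Z by (rule group_SL2Z)

lemma SL2Z_simps [simp]:
  "A \<in> carrier SL2Z \<longleftrightarrow> det A = 1" "A \<otimes>\<^bsub>SL2Z\<^esub> B = A ** B" "\<one>\<^bsub>SL2Z\<^esub> = mat 1"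
  by (simp_all add: SL2Z_def)

lemma SL2Z_inv: "det A = 1 \<Longrightarrow> inv\<^bsub>SL2Z\<^esub> A = adj A"
  by (rule SL2Z.inv_equality) (simp_all add: adj_inverse)

lemma normal_center: "{mat 1, - mat 1} \<lhd> SL2Z"
proof (rule SL2Z.normal_invI)
  show "subgroup {mat 1, - mat 1} SL2Z"
    by (rule SL2Z.subgroupI) (auto simp: SL2Z_inv mx_one)
qed (auto simp: SL2Z_inv adj_inverse)

interpretation center: normal "{mat 1, - mat 1}" SL2Z by (rule normal_center)

lemma group_PSL2Z: "group PSL2Z"
  unfolding PSL2Z_def by (rule center.factorgroup_is_group)

interpretation PSL2Z: group PSL2Z by (rule group_PSL2Z)

lemma coset_eq_cls: "{mat 1, - mat 1} #>\<^bsub>SL2Z\<^esub> A = cls A"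
  by (auto simp: r_coset_def cls_def)

lemma PSL2Z_carrier: "carrier PSL2Z = cls ` {A. det A = 1}"
  unfolding PSL2Z_def carrier_FactGroup coset_eq_cls by (simp add: SL2Z_def)

lemma PSL2Z_mult: "det A = 1 \<Longrightarrow> det B = 1 \<Longrightarrow> cls A \<otimes>\<^bsub>PSL2Z\<^esub> cls B = cls (A ** B)"
  using center.rcos_sum[of A B] by (simp add: PSL2Z_def coset_eq_cls)

lemma PSL2Z_one: "\<one>\<^bsub>PSL2Z\<^esub> = cls (mat 1)"
  by (simp add: PSL2Z_def cls_def)

lemma PSL2Z_inv: "det A = 1 \<Longrightarrow> inv\<^bsub>PSL2Z\<^esub> (cls A) = cls (adj A)"
  by (rule PSL2Z.inv_equality) (simp_all add: PSL2Z_carrier PSL2Z_mult PSL2Z_one adj_inverse)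

lemma cls_self [simp]: "A \<in> cls A"
  by (simp add: cls_def)

lemma subgroup_comm: "subgroup commutator_PSL2Z PSL2Z"
  unfolding commutator_PSL2Z_def by (rule PSL2Z.derived_is_subgroup) simp

lemma commutator_subset: "commutator_PSL2Z \<subseteq> cls ` comm_matrices"
  unfolding commutator_PSL2Z_def derived_def
proof (rule PSL2Z.generate_subgroup_incl)
  show "subgroup (cls ` comm_matrices) PSL2Z"
  proof (rule PSL2Z.subgroupI)
    show "cls ` comm_matrices \<subseteq> carrier PSL2Z" by (auto simp: PSL2Z_carrier comm_matrices_def)
    show "cls ` comm_matrices \<noteq> {}" using comm_matrices_one by blast
    fix C assume "C \<in> cls ` comm_matrices"
    then obtain A where A: "A \<in> comm_matrices" "C = cls A" by blast
    then show "inv\<^bsub>PSL2Z\<^esub> C \<in> cls ` comm_matrices"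
      using comm_matrices_adj[of A] by (simp add: PSL2Z_inv comm_matrices_def)
    fix D assume "D \<in> cls ` comm_matrices"
    then obtain B where B: "B \<in> comm_matrices" "D = cls B" by blast
    with A show "C \<otimes>\<^bsub>PSL2Z\<^esub> D \<in> cls ` comm_matrices"
      using comm_matrices_mult[of A B] by (simp add: PSL2Z_mult comm_matrices_def)
  qed
  show "derived_set PSL2Z (carrier PSL2Z) \<subseteq> cls ` comm_matrices"
  proof clarify
    fix C D assume "C \<in> carrier PSL2Z" "D \<in> carrier PSL2Z"
    then obtain A B where A: "det A = 1" "C = cls A" and B: "det B = 1" "D = cls B"
      by (auto simp: PSL2Z_carrier)
    have "6 dvd chi (A ** B ** adj A ** adj B)"
    proof -
      have "6 dvd chi (A ** B ** adj A ** adj B) - (chi (A ** B ** adj A) + chi (adj B))"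
        "6 dvd chi (A ** B ** adj A) - (chi (A ** B) + chi (adj A))"
        using A(1) B(1) by (simp_all add: chi_mult det_mul)
      from dvd_add[OF dvd_add[OF this] dvd_add[OF chi_mult[OF A(1) B(1)] dvd_add[OF chi_adj[OF A(1)] chi_adj[OF B(1)]]]]
      show ?thesis by (simp add: algebra_simps)
    qed
    then show "C \<otimes>\<^bsub>PSL2Z\<^esub> D \<otimes>\<^bsub>PSL2Z\<^esub> inv\<^bsub>PSL2Z\<^esub> C \<otimes>\<^bsub>PSL2Z\<^esub> inv\<^bsub>PSL2Z\<^esub> D \<in> cls ` comm_matrices"
      using A B by (simp add: PSL2Z_mult PSL2Z_inv det_mul comm_matrices_def)
  qed
qed

lemma cls_neg [simp]: "cls (- A) = cls A"
  by (auto simp: cls_def)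

lemma commutator_mult:
  assumes "det A = 1" "det B = 1" "cls A \<in> commutator_PSL2Z" "cls B \<in> commutator_PSL2Z"
  shows "cls (A ** B) \<in> commutator_PSL2Z"
  using subgroup.m_closed[OF subgroup_comm assms(3,4)] assms(1,2) by (simp add: PSL2Z_mult)

lemma commutator_intro:
  assumes "det A = 1" "det B = 1"
  shows "cls (A ** B ** adj A ** adj B) \<in> commutator_PSL2Z"
proof -
  have "cls A \<otimes>\<^bsub>PSL2Z\<^esub> cls B \<otimes>\<^bsub>PSL2Z\<^esub> inv\<^bsub>PSL2Z\<^esub> (cls A) \<otimes>\<^bsub>PSL2Z\<^esub> inv\<^bsub>PSL2Z\<^esub> (cls B) \<in> commutator_PSL2Z"
    unfolding commutator_PSL2Z_def derived_def
    using assms by (intro generate.incl) (auto simp: PSL2Z_carrier)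
  then show ?thesis using assms by (simp add: PSL2Z_mult PSL2Z_inv det_mul)
qed

text \<open>The commutator of two free generators of the commutator subgroup is parabolic of width 6.\<close>

lemma T6_commutator: "cls (Tpow (6 * n)) \<in> commutator_PSL2Z"
proof -
  have 1: "cls (Tpow 6) \<in> commutator_PSL2Z"
  proof -
    have "cls (mx 2 1 1 1 ** mx 2 (-1) (-1) 1 ** adj (mx 2 1 1 1) ** adj (mx 2 (-1) (-1) 1)) \<in> commutator_PSL2Z"
      by (rule commutator_intro) simp_all
    then show ?thesis using cls_neg[of "Tpow 6"] by simp
  qed
  have pos: "cls (Tpow (6 * int k)) \<in> commutator_PSL2Z" for k
  proof (induction k)
    case 0
    then show ?case using subgroup.one_closed[OF subgroup_comm] by (simp add: PSL2Z_one mx_one)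
  next
    case (Suc k)
    then show ?case using commutator_mult[OF _ _ 1 Suc] by (simp add: algebra_simps)
  qed
  have "cls (Tpow (- (6 * int k))) \<in> commutator_PSL2Z" for k
    using subgroup.m_inv_closed[OF subgroup_comm pos[of k]] by (simp add: PSL2Z_inv)
  with pos show ?thesis
    by (cases n rule: int_cases2) auto
qed

text \<open>
  Modulo the commutator subgroup every element is a power of \<open>T\<close>, because
  \<open>S T\<^sup>-\<^sup>3\<close> is a commutator up to sign; \<^const>\<open>chi\<close> determines the exponent modulo 6.
\<close>

lemma comm_matrices_subset:
  assumes "A \<in> comm_matrices" shows "cls A \<in> commutator_PSL2Z"
proof -
  have "\<exists>D n. det D = 1 \<and> cls D \<in> commutator_PSL2Z \<and> A = D ** Tpow n" if "det A = 1" for A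
    using that
  proof (induction A rule: SL2Z_induct)
    case one
    then show ?case using T6_commutator[of 0]
      by (intro exI[of _ "mat 1"] exI[of _ 0]) (simp add: mx_one)
  next
    case (T A n)
    then obtain D m where D: "det D = 1" "cls D \<in> commutator_PSL2Z" "A = D ** Tpow m" by blast
    then show ?case
      by (intro exI[of _ D] exI[of _ "m + n"]) (simp flip: matrix_mul_assoc add: add.commute)
  next
    case (S A)
    then obtain D m where D: "det D = 1" "cls D \<in> commutator_PSL2Z" "A = D ** Tpow m" by blast
    \<comment> \<open>Up to sign, \<open>E\<close> is the conjugate of \<open>S T\<^sup>-\<^sup>3\<close> by \<open>T\<^sup>m\<close>.\<close>
    define X where "X = Tpow (m + 1) ** Smat ** Tpow (- m - 1)"
    define E where "E = X ** Tpow 1 ** adj X ** adj (Tpow 1)"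
    have detX: "det X = 1" by (simp add: X_def algebra_simps)
    have E: "cls E \<in> commutator_PSL2Z" unfolding E_def by (rule commutator_intro) (simp_all add: detX)
    have detE: "det E = 1" by (simp add: E_def det_mul detX)
    have "A ** Smat = D ** (- E) ** Tpow (m + 3)"
      unfolding D(3) E_def X_def by (simp flip: matrix_mul_assoc add: algebra_simps)
    moreover have "cls (D ** (- E)) \<in> commutator_PSL2Z"
      using commutator_mult[OF D(1) detE D(2) E] by simp
    ultimately show ?case using D(1) detE by (intro exI[of _ "D ** (- E)"] exI[of _ "m + 3"]) (simp add: det_mul)
  qed
  then obtain D n where D: "det D = 1" "cls D \<in> commutator_PSL2Z" "A = D ** Tpow n"
    using assms unfolding comm_matrices_def by blast
  have "6 dvd chi D" 
  proof -
    obtain D' where "D' \<in> comm_matrices" "cls D = cls D'" using D(2) commutator_subset by auto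
    then have "D = D' \<or> D = - D'" by (auto simp: cls_def doubleton_eq_iff)
    then show ?thesis using \<open>D' \<in> comm_matrices\<close> comm_matrices_neg by (auto simp: comm_matrices_def)
  qed
  moreover have *: "6 dvd chi A" "6 dvd chi A - (chi D + n)"
    using assms chi_T[OF D(1), of n] D(3) by (simp_all add: comm_matrices_def)
  ultimately have "6 dvd n" using dvd_diff[OF dvd_diff[OF *]] by fastforce
  then obtain k where "n = 6 * k" by (elim dvdE)
  then show ?thesis using commutator_mult[OF D(1) _ D(2) T6_commutator[of k]] D(3) by simp
qed

lemma Union_commutator: "\<Union> commutator_PSL2Z = comm_matrices"
proof
  show "\<Union> commutator_PSL2Z \<subseteq> comm_matrices"
    using commutator_subset comm_matrices_neg by (fastforce simp: cls_def)
  show "comm_matrices \<subseteq> \<Union> commutator_PSL2Z"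
    using comm_matrices_subset cls_self by blast
qed

section \<open>The commutator subgroup is torsion free\<close>

lemma tr_mx [simp]: "tr (mx a b c d) = a + d"
  by (simp add: tr_def)

text \<open>
  An elliptic matrix has trace \<open>0\<close> or \<open>\<plusminus>1\<close>. In the first case \<^const>\<open>chi\<close> is odd, in the
  second it is not divisible by 3.
\<close>

lemma odd_chi_of_trace_zero:
  assumes "det A = 1" "tr A = 0" shows "odd (chi A)"
proof -
  obtain a b c d where A: "A = mx a b c d" by (rule mx_cases)
  have d: "d = - a" using assms(2) A by simp
  have det: "- (a * a) - b * c = 1" using assms(1) A d by simp
  show ?thesis
  proof (cases "even c")
    case False
    then show ?thesis using A d by simp
  next
    case True
    have "odd a"
    proof
      assume "even a"
      then have "even (- (a * a) - b * c)" using True by simp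
      then show False unfolding det by simp
    qed
    moreover have "odd b"
    proof
      assume "even b"
      obtain i j k where "a = 2 * i + 1" "b = 2 * j" "c = 2 * k"
        using \<open>odd a\<close> \<open>even b\<close> True by (meson evenE oddE)
      then have "4 * (- (i * i) - i - j * k) = 2" using det by (simp add: algebra_simps)
      then show False by presburger
    qed
    ultimately show ?thesis using A d True by simp
  qed
qed

lemma comm_matrices_trace:
  assumes "A \<in> comm_matrices" shows "\<bar>tr A\<bar> \<ge> 2"
proof (rule ccontr)
  assume "\<not> \<bar>tr A\<bar> \<ge> 2"
  obtain a b c d where A: "A = mx a b c d" by (rule mx_cases)
  define e where "e = tr A"
  have e: "e = 1 \<or> e = -1"
  proof -
    have "tr A \<noteq> 0"
      using odd_chi_of_trace_zero[of A] assms dvd_trans[of 2 "6::int" "chi A"] by (auto simp: comm_matrices_def)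
    then show ?thesis using \<open>\<not> \<bar>tr A\<bar> \<ge> 2\<close> unfolding e_def by linarith
  qed
  have d: "d = e - a" by (simp add: e_def A)
  have det: "a * e - a * a - b * c = 1" using assms A d by (simp add: comm_matrices_def algebra_simps)
  have "3 dvd chi A" using assms dvd_trans[of 3 "6::int"] by (simp add: comm_matrices_def)
  then have "3 dvd ((1 - c\<^sup>2) * (b * d) + c * e) + 3 * ((1 - c\<^sup>2) * (1 - d) - c)"
    unfolding A d by (simp add: algebra_simps)
  then have 3: "3 dvd (1 - c\<^sup>2) * (b * d) + c * e" by (simp add: dvd_add_left_iff)
  have "c mod 3 = 0 \<or> c mod 3 = 1 \<or> c mod 3 = 2" by presburger
  then show False
  proof (elim disjE)
    assume "c mod 3 = 0"
    then obtain k where c: "c = 3 * k" by auto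
    have "(1 - c\<^sup>2) * (b * d) + c * e = b * d + 3 * (k * e - 3 * k\<^sup>2 * b * d)"
      unfolding c by (simp add: algebra_simps power2_eq_square)
    with 3 have "3 dvd b * d" by (simp add: dvd_add_left_iff)
    moreover have aj: "\<exists>j. a = 3 * j - e"
    proof -
      have *: "a * e - a * a - 1 = 3 * (b * k)" using det c by (simp add: algebra_simps)
      define j r where "j = a div 3" and "r = a mod 3"
      have a: "a = 3 * j + r" by (simp add: j_def r_def)
      have r: "r = 0 \<or> r = 1 \<or> r = 2" unfolding r_def by presburger
      have "3 dvd r * e - r * r - 1"
      proof -
        have "r * e - r * r - 1 = 3 * (b * k - j * e + 3 * j * j + 2 * j * r)"
          using * unfolding a by (simp add: algebra_simps)
        then show ?thesis by (metis dvd_triv_left)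
      qed
      with e r have "3 dvd r + e" by auto
      then show ?thesis unfolding a by (elim dvdE, intro exI[of _ "j + _"]) (simp add: algebra_simps)
    qed
    then obtain j where a: "a = 3 * j - e" by blast
    have "\<not> 3 dvd d" using e unfolding d a by (elim disjE) presburger+
    ultimately have "3 dvd b" using prime_dvd_mult_iff[of "3::int" b d] by simp
    then obtain l where b: "b = 3 * l" by auto
    have "9 * (e * j - j * j - l * k) = 3 * e * e"
      using det e unfolding a b c by (elim disjE) (simp_all add: algebra_simps)
    then show False using e by (elim disjE; simp) presburger+
  next
    assume "c mod 3 = 1"
    then obtain k where c: "c = 3 * k + 1" by (metis mult_div_mod_eq)
    have "(1 - c\<^sup>2) * (b * d) + c * e = e + 3 * (k * e - (3 * k\<^sup>2 + 2 * k) * (b * d))"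
      unfolding c by (simp add: algebra_simps power2_eq_square)
    with 3 have "3 dvd e" by (simp add: dvd_add_left_iff)
    then show False using e by auto
  next
    assume "c mod 3 = 2"
    then obtain k where c: "c = 3 * k + 2" by (metis mult_div_mod_eq)
    have "(1 - c\<^sup>2) * (b * d) + c * e = 2 * e + 3 * (k * e - (3 * k\<^sup>2 + 4 * k + 1) * (b * d))"
      unfolding c by (simp add: algebra_simps power2_eq_square)
    with 3 have "3 dvd 2 * e" by (simp add: dvd_add_left_iff)
    then show False using e by auto
  qed
qed

section \<open>The action on the upper half-plane\<close>

lemma moebius_mx: "moebius (mx a b c d) z = (of_int a * z + of_int b) / (of_int c * z + of_int d)"
  by (simp add: moebius_def)

lemma moebius_neg [simp]: "moebius (- A) z = moebius A z"
proof -
  obtain a b c d where A: "A = mx a b c d" by (rule mx_cases)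
  have "moebius (- A) z = (- (of_int a * z + of_int b)) / (- (of_int c * z + of_int d))"
    unfolding A by (simp add: moebius_mx)
  then show ?thesis unfolding A moebius_mx minus_divide_left[symmetric] minus_divide_right[symmetric] by simp
qed

lemma moebius_one [simp]: "moebius (mat 1) z = z"
  by (simp add: mx_one moebius_mx)

lemma denom_nonzero:
  assumes "a * d - b * c = 1" "Im z > 0" shows "of_int c * z + of_int d \<noteq> 0"
proof
  assume *: "of_int c * z + of_int d = 0"
  then have "Im (of_int c * z + of_int d) = 0" by simp
  then have "c = 0" using assms(2) by simp
  with * assms(1) show False by auto
qed

lemma Im_moebius_mx:
  assumes "a * d - b * c = 1" 
  shows "Im (moebius (mx a b c d) z) = Im z / (cmod (of_int c * z + of_int d))\<^sup>2"
proof -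
  have det: "real_of_int a * of_int d - of_int b * of_int c = 1"
    using assms by (metis of_int_1 of_int_diff of_int_mult)
  have "Im (moebius (mx a b c d) z) =
      (of_int a * of_int d - of_int b * of_int c) * Im z / (cmod (of_int c * z + of_int d))\<^sup>2"
    by (simp add: moebius_mx Im_divide cmod_power2 algebra_simps)
  then show ?thesis by (simp add: det)
qed

lemma moebius_H2:
  assumes "det A = 1" "z \<in> H2" shows "moebius A z \<in> H2"
proof -
  obtain a b c d where A: "A = mx a b c d" by (rule mx_cases)
  show ?thesis using assms denom_nonzero[of a d b c z] unfolding A H2_def
    by (simp add: Im_moebius_mx)
qed

lemma moebius_mult:
  assumes "det B = 1" "z \<in> H2" shows "moebius (A ** B) z = moebius A (moebius B z)"
proof -
  obtain a b c d where A: "A = mx a b c d" by (rule mx_cases)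
  obtain a' b' c' d' where B: "B = mx a' b' c' d'" by (rule mx_cases)
  define n where "n = of_int a' * z + of_int b'"
  define m where "m = of_int c' * z + of_int d'"
  have m: "m \<noteq> 0"
    using denom_nonzero[of a' d' b' c' z] assms unfolding B H2_def m_def by simp
  have "moebius A (moebius B z) = (of_int a * (n / m) + of_int b) / (of_int c * (n / m) + of_int d)"
    unfolding A B moebius_mx n_def m_def ..
  also have "\<dots> = ((of_int a * n + of_int b * m) / m) / ((of_int c * n + of_int d * m) / m)"
    using m by (simp add: field_simps)
  also have "\<dots> = (of_int a * n + of_int b * m) / (of_int c * n + of_int d * m)"
    using m by simp
  also have "\<dots> = moebius (A ** B) z"
    unfolding A B by (simp add: moebius_mx n_def m_def algebra_simps)
  finally show ?thesis ..
qed

lemma moebius_adj: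
  assumes "det A = 1" "z \<in> H2"
  shows "moebius (adj A) (moebius A z) = z" "moebius A (moebius (adj A) z) = z"
  using assms moebius_mult[of A z "adj A"] moebius_mult[of "adj A" z A] by (simp_all add: adj_inverse)

lemma continuous_on_moebius:
  assumes "det A = 1" shows "continuous_on H2 (moebius A)"
proof -
  obtain a b c d where A: "A = mx a b c d" by (rule mx_cases)
  show ?thesis unfolding A moebius_mx
    using denom_nonzero[of a d b c] assms
    by (intro continuous_intros ballI) (auto simp: A H2_def)
qed

text \<open>
  A matrix with a fixed point in the upper half-plane is \<open>\<plusminus>1\<close> or elliptic, since the quadratic
  equation of the fixed points has discriminant \<open>(tr A)\<^sup>2 - 4\<close>.
\<close>

lemma fixed_point_trace:
  assumes "det A = 1" "z \<in> H2" "moebius A z = z" "\<bar>tr A\<bar> \<ge> 2"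
  shows "A = mat 1 \<or> A = - mat 1"
proof -
  obtain a b c d where A: "A = mx a b c d" by (rule mx_cases)
  define x y where "x = Re z" and "y = Im z"
  have z: "z = Complex x y" by (simp add: x_def y_def)
  have y: "y > 0" using assms(2) by (simp add: H2_def y_def)
  have det: "a * d - b * c = 1" using assms(1) A by simp
  have "of_int c * z + of_int d \<noteq> 0" using denom_nonzero[OF det] y by (simp add: y_def)
  then have eq: "of_int a * z + of_int b = z * (of_int c * z + of_int d)"
    using assms(3) unfolding A moebius_mx by (simp add: divide_eq_eq)
  have "Im (of_int a * z + of_int b) = Im (z * (of_int c * z + of_int d))"
    "Re (of_int a * z + of_int b) = Re (z * (of_int c * z + of_int d))"
    by (simp_all only: eq)
  then have im: "of_int a * y = x * (of_int c * y) + y * (of_int c * x + of_int d)"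
    and re: "of_int a * x + of_int b = x * (of_int c * x + of_int d) - y * (of_int c * y)"
    by (simp_all add: z)
  have "y * of_int a = y * (2 * of_int c * x + of_int d)" using im by (simp add: algebra_simps)
  then have ad: "of_int a = 2 * of_int c * x + of_int d" using y by simp
  have b: "of_int b = - of_int c * (x\<^sup>2 + y\<^sup>2)"
    using re unfolding ad by (simp add: algebra_simps power2_eq_square)
  have "real_of_int ((a + d)\<^sup>2 - 4) = (of_int a - of_int d)\<^sup>2 + 4 * of_int b * of_int c"
    using arg_cong[OF det, of real_of_int] by (simp add: power2_eq_square algebra_simps)
  also have "\<dots> = - (2 * of_int c * y)\<^sup>2"
    unfolding ad b by (simp add: power2_eq_square algebra_simps)
  finally have disc: "real_of_int ((a + d)\<^sup>2 - 4) = - (2 * of_int c * y)\<^sup>2" .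
  have "2\<^sup>2 \<le> \<bar>a + d\<bar>\<^sup>2" using assms(4) unfolding A tr_mx by (intro power_mono) auto
  then have "(a + d)\<^sup>2 - 4 \<ge> 0" by simp
  then have "real_of_int ((a + d)\<^sup>2 - 4) \<ge> 0" by (simp only: of_int_0_le_iff)
  with disc have "c = 0" using y by simp
  with ad b have "a = d" "b = 0" by auto
  with det \<open>c = 0\<close> have "a = 1 \<or> a = -1" by (auto simp: zmult_eq_1_iff)
  with \<open>c = 0\<close> \<open>b = 0\<close> \<open>a = d\<close> show ?thesis by (auto simp: A mx_one)
qed

lemma comm_matrices_free:
  assumes "A \<in> comm_matrices" "z \<in> H2" "moebius A z = z" shows "A = mat 1 \<or> A = - mat 1"
  using assms fixed_point_trace comm_matrices_trace[OF assms(1)] by (auto simp: comm_matrices_def)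

lemma torus_proj_eq:
  assumes "z \<in> H2" shows "torus_proj z = (\<lambda>A. moebius A z) ` comm_matrices"
  using assms by (auto simp: torus_proj_def orbit_rel_def simp flip: Union_commutator)

lemma torus_proj_eq_iff:
  assumes "z \<in> H2" "w \<in> H2"
  shows "torus_proj z = torus_proj w \<longleftrightarrow> (\<exists>A\<in>comm_matrices. w = moebius A z)"
proof
  assume "torus_proj z = torus_proj w"
  moreover have "w \<in> torus_proj w"
    using assms comm_matrices_one by (force simp: torus_proj_eq)
  ultimately show "\<exists>A\<in>comm_matrices. w = moebius A z" using assms by (auto simp: torus_proj_eq)
next
  assume "\<exists>A\<in>comm_matrices. w = moebius A z"
  then obtain A where A: "A \<in> comm_matrices" "w = moebius A z" by blast
  have det: "det A = 1" using A by (simp add: comm_matrices_def)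
  have "moebius B z \<in> torus_proj w" if "B \<in> comm_matrices" for B
  proof -
    have "moebius (B ** adj A) w = moebius B z"
      using A det assms by (subst moebius_mult) (simp_all add: moebius_adj)
    then show ?thesis
      using assms comm_matrices_mult[OF that comm_matrices_adj[OF A(1)]] by (force simp: torus_proj_eq)
  qed
  moreover have "moebius B w \<in> torus_proj z" if "B \<in> comm_matrices" for B
    using assms A det comm_matrices_mult[OF that A(1)] moebius_mult[of A z B] by (force simp: torus_proj_eq)
  ultimately show "torus_proj z = torus_proj w" using assms by (auto simp: torus_proj_eq)
qed

section \<open>Proper discontinuity and lifts\<close>

definition entries_le :: "int \<Rightarrow> (int^2^2) set" where
  "entries_le N = (\<lambda>(a, b, c, d). mx a b c d) ` ({-N..N} \<times> {-N..N} \<times> {-N..N} \<times> {-N..N})"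

lemma finite_entries_le: "finite (entries_le N)"
  by (simp add: entries_le_def)

text \<open>
  If a matrix moves a point near \<open>z\<close> to a point near \<open>z\<close>, then comparison of the imaginary parts
  bounds \<open>\<bar>c z + d\<bar>\<close>, hence the lower row, and the images then bound the upper row.
\<close>

lemma entries_bounded_near:
  assumes "z \<in> H2"
  obtains N where "\<And>A w w'. det A = 1 \<Longrightarrow> w \<in> ball z (Im z / 2) \<Longrightarrow> w' \<in> ball z (Im z / 2) \<Longrightarrow>
    moebius A w = w' \<Longrightarrow> A \<in> entries_le N"
proof -
  define y where "y = Im z"
  have y: "y > 0" using assms by (simp add: y_def H2_def)
  define R where "R = cmod z + y"
  have R: "R > 0" unfolding R_def using y by (simp add: add_nonneg_pos)
  define M where "M = Max {4 / y, 2 + (4 / y) * R, 4 * R / y, 2 * R + (4 * R / y) * R}"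
  define N where "N = \<lceil>M\<rceil>"
  have NI: "k \<in> {-N..N}" if "\<bar>real_of_int k\<bar> \<le> t" "t \<in> {4 / y, 2 + (4 / y) * R, 4 * R / y, 2 * R + (4 * R / y) * R}" for k t
  proof -
    have "t \<le> M" unfolding M_def using that(2) by (intro Max_ge) auto
    with that(1) have "\<bar>real_of_int k\<bar> \<le> of_int N" unfolding N_def by linarith
    then show ?thesis by auto
  qed
  show ?thesis
  proof (rule that[of N])
    fix A w w'
    assume det: "det A = 1" and w: "w \<in> ball z (Im z / 2)" and w': "w' \<in> ball z (Im z / 2)"
      and eq: "moebius A w = w'"
    obtain a b c d where A: "A = mx a b c d" by (rule mx_cases)
    have *: "y / 2 < Im u \<and> Im u < 3 * y / 2 \<and> cmod u \<le> R" if "u \<in> ball z (Im z / 2)" for u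
    proof -
      have d: "cmod (z - u) < y / 2" using that by (simp add: dist_norm y_def)
      have "\<bar>Im (z - u)\<bar> \<le> cmod (z - u)" by (rule abs_Im_le_cmod)
      then have "\<bar>y - Im u\<bar> < y / 2" using d by (simp add: y_def)
      moreover have "cmod u \<le> cmod z + cmod (z - u)"
        by (metis norm_minus_commute norm_triangle_sub)
      ultimately show ?thesis unfolding R_def using d y by linarith
    qed
    define m where "m = of_int c * w + of_int d"
    have det': "a * d - b * c = 1" using det A by simp
    have m0: "m \<noteq> 0" unfolding m_def using *[OF w] y by (intro denom_nonzero[OF det']) simp
    have "Im w' = Im w / (cmod m)\<^sup>2" unfolding m_def eq[symmetric] A by (rule Im_moebius_mx[OF det'])
    then have "(cmod m)\<^sup>2 * Im w' = Im w" using m0 by (simp add: field_simps)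
    moreover have "(cmod m)\<^sup>2 * (y / 2) \<le> (cmod m)\<^sup>2 * Im w'"
      using *[OF w'] by (intro mult_left_mono) auto
    ultimately have "(cmod m)\<^sup>2 * (y / 2) \<le> 3 * y / 2" using *[OF w] by linarith
    then have "(cmod m)\<^sup>2 \<le> 2\<^sup>2" using y by (simp add: field_simps)
    then have m2: "cmod m \<le> 2" by (rule power2_le_imp_le) simp
    have "\<bar>Im m\<bar> \<le> 2" using abs_Im_le_cmod[of m] m2 by linarith
    then have cw: "\<bar>of_int c\<bar> * Im w \<le> 2" using *[OF w] y by (simp add: m_def abs_mult)
    have "\<bar>real_of_int c\<bar> * (y / 2) \<le> \<bar>of_int c\<bar> * Im w" using *[OF w] by (intro mult_left_mono) auto
    with cw have c: "\<bar>real_of_int c\<bar> \<le> 4 / y" using y by (simp add: field_simps)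
    have "of_int d = m - of_int c * w" by (simp add: m_def)
    then have "cmod (of_int d) \<le> cmod m + cmod (of_int c * w)" by (metis norm_triangle_ineq4)
    also have "\<dots> \<le> 2 + (4 / y) * R"
      unfolding norm_mult using m2 c *[OF w] y by (intro add_mono mult_mono) auto
    finally have d: "\<bar>real_of_int d\<bar> \<le> 2 + (4 / y) * R" by simp
    define n where "n = of_int a * w + of_int b"
    have "n = w' * m" using eq m0 unfolding A moebius_mx n_def m_def by (simp add: field_simps)
    then have n: "cmod n \<le> 2 * R"
      using m2 *[OF w'] R mult_mono[of "cmod w'" R "cmod m" 2] by (simp add: norm_mult)
    have "\<bar>Im n\<bar> \<le> 2 * R" using abs_Im_le_cmod[of n] n by linarith
    then have aw: "\<bar>of_int a\<bar> * Im w \<le> 2 * R" using *[OF w] y by (simp add: n_def abs_mult)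
    have "\<bar>real_of_int a\<bar> * (y / 2) \<le> \<bar>of_int a\<bar> * Im w" using *[OF w] by (intro mult_left_mono) auto
    with aw have a: "\<bar>real_of_int a\<bar> \<le> 4 * R / y" using y by (simp add: field_simps)
    have "of_int b = n - of_int a * w" by (simp add: n_def)
    then have "cmod (of_int b) \<le> cmod n + cmod (of_int a * w)" by (metis norm_triangle_ineq4)
    also have "\<dots> \<le> 2 * R + (4 * R / y) * R"
      unfolding norm_mult using n a *[OF w] y R by (intro add_mono mult_mono) auto
    finally have b: "\<bar>real_of_int b\<bar> \<le> 2 * R + (4 * R / y) * R" by simp
    show "A \<in> entries_le N"
      unfolding A entries_le_def using NI[OF a] NI[OF b] NI[OF c] NI[OF d] by force
  qed
qed

lemma comm_matrices_discontinuous: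
  assumes z: "z \<in> H2"
  obtains e where "e > 0" and "\<And>A w w'. A \<in> comm_matrices \<Longrightarrow> w \<in> ball z e \<Longrightarrow> w' \<in> ball z e \<Longrightarrow>
    moebius A w = w' \<Longrightarrow> A = mat 1 \<or> A = - mat 1"
proof -
  obtain N where N: "\<And>A w w'. det A = 1 \<Longrightarrow> w \<in> ball z (Im z / 2) \<Longrightarrow> w' \<in> ball z (Im z / 2) \<Longrightarrow>
    moebius A w = w' \<Longrightarrow> A \<in> entries_le N" using entries_bounded_near[OF z] by blast
  define F where "F = {A \<in> comm_matrices \<inter> entries_le N. A \<noteq> mat 1 \<and> A \<noteq> - mat 1}"
  have openH2: "open H2" unfolding H2_def by (rule open_halfspace_Im_gt)
  have "\<forall>A\<in>F. \<forall>\<^sub>F e in at_right 0. \<forall>w\<in>ball z e. \<forall>w'\<in>ball z e. moebius A w \<noteq> w'"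
  proof
    fix A assume "A \<in> F"
    then have A: "A \<in> comm_matrices" "A \<noteq> mat 1" "A \<noteq> - mat 1" by (auto simp: F_def)
    define \<delta> where "\<delta> = dist (moebius A z) z / 3"
    have \<delta>: "\<delta> > 0" using comm_matrices_free[OF A(1) z] A(2,3) by (auto simp: \<delta>_def)
    have "continuous (at z) (moebius A)"
      using continuous_on_moebius[of A] A(1) openH2 z
      by (auto simp: comm_matrices_def continuous_on_eq_continuous_at)
    then obtain r where r: "r > 0" "\<And>w. dist w z < r \<Longrightarrow> dist (moebius A w) (moebius A z) < \<delta>"
      using \<delta> unfolding continuous_at_eps_delta by (auto simp: dist_norm)
    have "\<forall>w\<in>ball z e. \<forall>w'\<in>ball z e. moebius A w \<noteq> w'" if "0 < e" "e < min r \<delta>" for e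
    proof (intro ballI notI)
      fix w w' assume w: "w \<in> ball z e" "w' \<in> ball z e" and eq: "moebius A w = w'"
      have "dist (moebius A w) (moebius A z) < \<delta>" "dist w' z < \<delta>"
        using r w that by (auto simp: dist_commute)
      with eq have "dist (moebius A z) z < 2 * \<delta>"
        using dist_triangle2[of "moebius A z" z w'] by (simp add: dist_commute)
      then show False using \<delta> by (simp add: \<delta>_def)
    qed
    then show "\<forall>\<^sub>F e in at_right 0. \<forall>w\<in>ball z e. \<forall>w'\<in>ball z e. moebius A w \<noteq> w'"
      using r(1) \<delta> unfolding eventually_at_right_field by (intro exI[of _ "min r \<delta>"]) auto
  qed
  then have "\<forall>\<^sub>F e in at_right 0. \<forall>A\<in>F. \<forall>w\<in>ball z e. \<forall>w'\<in>ball z e. moebius A w \<noteq> w'"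
    by (intro eventually_ball_finite) (auto simp: F_def finite_entries_le)
  then obtain b where b: "b > 0" "\<And>e. 0 < e \<Longrightarrow> e < b \<Longrightarrow> \<forall>A\<in>F. \<forall>w\<in>ball z e. \<forall>w'\<in>ball z e. moebius A w \<noteq> w'"
    unfolding eventually_at_right_field by auto
  have imz: "Im z > 0" using z by (simp add: H2_def)
  define e where "e = min (b / 2) (Im z / 2)"
  have e: "0 < e" "e < b" "e \<le> Im z / 2" using b(1) imz by (auto simp: e_def)
  show ?thesis
  proof (rule that[OF e(1)])
    fix A w w' assume A: "A \<in> comm_matrices" and w: "w \<in> ball z e" "w' \<in> ball z e" and eq: "moebius A w = w'"
    have "A \<in> entries_le N" using A w eq e(3) by (intro N[of A w w']) (auto simp: comm_matrices_def)
    then show "A = mat 1 \<or> A = - mat 1"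
      using b(2)[OF e(1,2)] A w eq unfolding F_def by blast
  qed
qed

text \<open>
  Two lifts of a curve differ by an element of the commutator subgroup: the set of times at which a
  fixed element carries one lift to the other is closed by continuity and open by proper
  discontinuity.
\<close>

lemma lift_unique:
  fixes \<gamma> \<beta> :: "real \<Rightarrow> complex"
  assumes \<gamma>: "continuous_on UNIV \<gamma>" "range \<gamma> \<subseteq> H2" and \<beta>: "continuous_on UNIV \<beta>" "range \<beta> \<subseteq> H2"
    and eq: "torus_proj \<circ> \<gamma> = torus_proj \<circ> \<beta>"
  obtains A where "A \<in> comm_matrices" "\<And>t. \<gamma> t = moebius A (\<beta> t)"
proof -
  have \<gamma>H: "\<gamma> t \<in> H2" and \<beta>H: "\<beta> t \<in> H2" for t using \<gamma>(2) \<beta>(2) by auto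
  have orb: "\<exists>B\<in>comm_matrices. \<gamma> t = moebius B (\<beta> t)" for t
    using eq torus_proj_eq_iff[OF \<beta>H \<gamma>H, of t t] by (metis comp_apply)
  obtain A where A: "A \<in> comm_matrices" "\<gamma> 0 = moebius A (\<beta> 0)" using orb by blast
  have det: "det A = 1" using A by (simp add: comm_matrices_def)
  define T where "T = {t. \<gamma> t = moebius A (\<beta> t)}"
  have cont: "continuous_on UNIV (\<lambda>t. moebius A (\<beta> t))"
    using continuous_on_compose2[OF continuous_on_moebius[OF det] \<beta>(1)] \<beta>(2) by blast
  have "closed T" unfolding T_def using \<gamma>(1) cont by (rule closed_Collect_eq)
  moreover have "open T"
  unfolding open_subopen[of T]
  proof
    fix t assume "t \<in> T"
    then have t: "moebius (adj A) (\<gamma> t) = \<beta> t" using det \<beta>H by (simp add: T_def moebius_adj)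
    obtain e where e: "e > 0" "\<And>A w w'. A \<in> comm_matrices \<Longrightarrow> w \<in> ball (\<beta> t) e \<Longrightarrow> w' \<in> ball (\<beta> t) e \<Longrightarrow>
        moebius A w = w' \<Longrightarrow> A = mat 1 \<or> A = - mat 1"
      using comm_matrices_discontinuous[OF \<beta>H] by blast
    have "continuous_on UNIV (\<lambda>t. moebius (adj A) (\<gamma> t))"
      using continuous_on_compose2[OF continuous_on_moebius \<gamma>(1)] \<gamma>(2) det by (metis det_adj)
    then have op: "open {s. moebius (adj A) (\<gamma> s) \<in> ball (\<beta> t) e \<and> \<beta> s \<in> ball (\<beta> t) e}"
      using \<beta>(1) by (intro open_Collect_conj) (auto simp: continuous_on_open_vimage vimage_def)
    have "{s. moebius (adj A) (\<gamma> s) \<in> ball (\<beta> t) e \<and> \<beta> s \<in> ball (\<beta> t) e} \<subseteq> T"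
    proof clarify
      fix s assume s: "moebius (adj A) (\<gamma> s) \<in> ball (\<beta> t) e" "\<beta> s \<in> ball (\<beta> t) e"
      obtain B where B: "B \<in> comm_matrices" "\<gamma> s = moebius B (\<beta> s)" using orb by blast
      have "moebius (adj A ** B) (\<beta> s) = moebius (adj A) (\<gamma> s)"
        using B \<beta>H by (simp add: moebius_mult comm_matrices_def)
      then have "adj A ** B = mat 1 \<or> adj A ** B = - mat 1"
        using e(2)[OF comm_matrices_mult[OF comm_matrices_adj[OF A(1)] B(1)] s(2) s(1)] by blast
      then have "A ** (adj A ** B) = A \<or> A ** (adj A ** B) = - A" by auto
      then have "B = A \<or> B = - A" using det by (simp add: matrix_mul_assoc adj_inverse)
      then show "s \<in> T" using B by (auto simp: T_def)
    qed
    moreover have "t \<in> {s. moebius (adj A) (\<gamma> s) \<in> ball (\<beta> t) e \<and> \<beta> s \<in> ball (\<beta> t) e}"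
      using t e(1) by simp
    ultimately show "\<exists>U. open U \<and> t \<in> U \<and> U \<subseteq> T" using op by blast
  qed
  moreover have "0 \<in> T" using A by (simp add: T_def)
  ultimately have "T = UNIV" using clopen by blast
  then show ?thesis using that A(1) by (auto simp: T_def)
qed

section \<open>Vertical geodesics\<close>

lemma vertical_in_H2: "vertical_geodesic x t \<in> H2"
  by (simp add: vertical_geodesic_def H2_def)

lemma vertical_eq: "vertical_geodesic x t = of_real x + of_real (exp t) * \<i>"
  by (simp add: vertical_geodesic_def complex_eq_iff)

lemma continuous_vertical: "continuous_on UNIV (vertical_geodesic x)"
  unfolding vertical_eq by (intro continuous_intros)

text \<open>
  The derivative of \<open>ln \<circ> Im\<close> along a path is bounded by the integrand of its length.
\<close>

lemma hyp_length_ge: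
  assumes p: "valid_path p" "path_image p \<subseteq> H2" and L: "has_hyp_length p L"
  shows "\<bar>ln (Im (pathfinish p)) - ln (Im (pathstart p))\<bar> \<le> L"
proof -
  define f where "f = (\<lambda>t. Im (vector_derivative p (at t)) / Im (p t))"
  have pos: "Im (p t) > 0" if "t \<in> {0..1}" for t
    using p(2) that unfolding path_image_def H2_def by blast
  have cont: "continuous_on {0..1} p"
    using p(1) by (simp add: valid_path_def piecewise_C1_differentiable_on_def)
  obtain S where S: "finite S" "\<And>t. t \<in> {0..1} - S \<Longrightarrow> p differentiable at t"
    using p(1) by (auto simp: valid_path_def piecewise_C1_differentiable_on_def C1_differentiable_on_eq)
  have "(f has_integral ln (Im (p 1)) - ln (Im (p 0))) {0..1}"
  proof (rule fundamental_theorem_of_calculus_interior_strong[OF S(1)])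
    fix t :: real assume t: "t \<in> {0<..<1} - S"
    then have "(p has_vector_derivative vector_derivative p (at t)) (at t)"
      using S(2)[of t] by (simp add: vector_derivative_works)
    then have "((\<lambda>t. Im (p t)) has_real_derivative Im (vector_derivative p (at t))) (at t)"
      unfolding has_real_derivative_iff_has_vector_derivative by (rule bounded_linear.has_vector_derivative[OF bounded_linear_Im])
    from DERIV_chain2[OF DERIV_ln this] have "((\<lambda>t. ln (Im (p t))) has_real_derivative f t) (at t)"
      unfolding f_def using pos[of t] t by (simp add: field_simps)
    then show "((\<lambda>t. ln (Im (p t))) has_vector_derivative f t) (at t)"
      by (simp add: has_real_derivative_iff_has_vector_derivative)
  next
    show "continuous_on {0..1} (\<lambda>t. ln (Im (p t)))"
      using cont pos by (intro continuous_intros) force+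
  qed simp
  note fint = this
  have "\<bar>f t\<bar> \<le> norm (vector_derivative p (at t)) / Im (p t)" if "t \<in> {0..1}" for t
    using pos[OF that] abs_Im_le_cmod by (simp add: f_def abs_div divide_right_mono)
  then have le: "f t \<le> norm (vector_derivative p (at t)) / Im (p t)"
      "- f t \<le> norm (vector_derivative p (at t)) / Im (p t)" if "t \<in> {0..1}" for t
    using that by (auto simp: abs_le_iff)
  have "ln (Im (p 1)) - ln (Im (p 0)) \<le> L"
    by (rule has_integral_le[OF fint L[unfolded has_hyp_length_def] le(1)])
  moreover have "- (ln (Im (p 1)) - ln (Im (p 0))) \<le> L"
    by (rule has_integral_le[OF has_integral_neg[OF fint] L[unfolded has_hyp_length_def] le(2)])
  ultimately show ?thesis by (simp add: pathstart_def pathfinish_def)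
qed

lemma hyp_dist_vertical: "hyp_dist (vertical_geodesic x s) (vertical_geodesic x t) = \<bar>s - t\<bar>"
  unfolding hyp_dist_def
proof (rule cInf_eq_minimum)
  define p where "p = (\<lambda>u. of_real x + of_real (exp (s + u * (t - s))) * \<i>)"
  have der: "(p has_vector_derivative of_real (exp (s + u * (t - s)) * (t - s)) * \<i>) (at u)" for u
  proof -
    have "((\<lambda>u. exp (s + u * (t - s))) has_real_derivative exp (s + u * (t - s)) * (t - s)) (at u)"
      by (auto intro!: derivative_eq_intros)
    then show ?thesis unfolding p_def
      by (auto intro!: derivative_eq_intros simp: has_real_derivative_iff_has_vector_derivative)
  qed
  have vd: "vector_derivative p (at u) = of_real (exp (s + u * (t - s)) * (t - s)) * \<i>" for u
    by (rule vector_derivative_at[OF der])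
  have "valid_path p"
    unfolding valid_path_def
  proof (rule C1_differentiable_imp_piecewise)
    show "p C1_differentiable_on {0..1}"
      unfolding C1_differentiable_on_def using der by (intro exI conjI ballI) (auto intro!: continuous_intros)
  qed
  moreover have "path_image p \<subseteq> H2" by (auto simp: path_image_def p_def H2_def)
  moreover have "pathstart p = vertical_geodesic x s" "pathfinish p = vertical_geodesic x t"
    by (simp_all add: pathstart_def pathfinish_def p_def vertical_eq)
  moreover have "has_hyp_length p \<bar>s - t\<bar>"
  proof -
    have "norm (vector_derivative p (at u)) / Im (p u) = \<bar>s - t\<bar>" for u
      unfolding vd norm_mult norm_of_real norm_ii by (simp add: p_def abs_mult)
    then show ?thesis
      using has_integral_const_real[of "\<bar>s - t\<bar>" 0 1] by (simp add: has_hyp_length_def)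
  qed
  ultimately show "\<bar>s - t\<bar> \<in> {L. \<exists>p. valid_path p \<and> path_image p \<subseteq> H2 \<and>
     pathstart p = vertical_geodesic x s \<and> pathfinish p = vertical_geodesic x t \<and> has_hyp_length p L}"
    by blast
next
  fix L assume "L \<in> {L. \<exists>p. valid_path p \<and> path_image p \<subseteq> H2 \<and>
     pathstart p = vertical_geodesic x s \<and> pathfinish p = vertical_geodesic x t \<and> has_hyp_length p L}"
  then obtain p where p: "valid_path p" "path_image p \<subseteq> H2" "has_hyp_length p L"
    "pathstart p = vertical_geodesic x s" "pathfinish p = vertical_geodesic x t" by blast
  then show "\<bar>s - t\<bar> \<le> L"
    using hyp_length_ge[OF p(1-3)] by (simp add: vertical_geodesic_def abs_minus_commute)
qed

lemma torus_geodesic_vertical: "torus_geodesic (torus_proj \<circ> vertical_geodesic x)"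
proof -
  have "hyp_geodesic (vertical_geodesic x)"
    unfolding hyp_geodesic_def hyp_dist_vertical
    using vertical_in_H2 by (auto intro: exI[of _ 1])
  then show ?thesis unfolding torus_geodesic_def by blast
qed

section \<open>Ends in the cusp\<close>

lemma vertical_at_bot: "(vertical_geodesic x \<longlongrightarrow> of_real x) at_bot"
proof -
  have "((\<lambda>t. of_real x + of_real (exp t) * \<i>) \<longlongrightarrow> of_real x + of_real 0 * \<i>) at_bot"
    by (intro tendsto_intros exp_at_bot)
  then show ?thesis by (simp add: vertical_eq[abs_def])
qed

lemma vertical_at_top: "filterlim (vertical_geodesic x) at_infinity at_top"
proof (rule filterlim_norm_at_top_imp_at_infinity)
  have "exp t \<le> norm (vertical_geodesic x t)" for t
    using abs_Im_le_cmod[of "vertical_geodesic x t"] by (simp add: vertical_geodesic_def)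
  then show "filterlim (\<lambda>t. norm (vertical_geodesic x t)) at_top at_top"
    by (intro filterlim_at_top_mono[OF exp_at_top]) simp
qed

lemma moebius_at_infinity:
  assumes det: "det A = 1" and f: "filterlim f at_infinity F"
  shows "tends_to_cusp (\<lambda>t. moebius A (f t)) F"
proof -
  obtain a b c d where A: "A = mx a b c d" by (rule mx_cases)
  show ?thesis
  proof (cases "c = 0")
    case True
    then have "a * d = 1" using det A by simp
    then have a: "a \<noteq> 0" "d \<noteq> 0" by auto
    have "filterlim (\<lambda>t. of_int a / of_int d * f t + of_int b / of_int d :: complex) at_infinity F"
      using a by (intro tendsto_add_filterlim_at_infinity' tendsto_mult_filterlim_at_infinity[OF tendsto_const _ f] tendsto_const) auto
    then have "filterlim (\<lambda>t. moebius A (f t)) at_infinity F"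
      using True by (simp add: A moebius_mx add_divide_distrib)
    then show ?thesis by (simp add: tends_to_cusp_def)
  next
    case False
    have "((\<lambda>t. (of_int a + of_int b * inverse (f t)) / (of_int c + of_int d * inverse (f t))) \<longlongrightarrow>
        (of_int a + of_int b * 0) / (of_int c + of_int d * 0)) F"
      using False by (intro tendsto_intros filterlim_compose[OF tendsto_inverse_0 f]) auto
    moreover have "\<forall>\<^sub>F t in F. (of_int a + of_int b * inverse (f t)) / (of_int c + of_int d * inverse (f t)) = moebius A (f t)"
      using filterlim_at_infinity_imp_eventually_ne[OF f, of 0]
    proof eventually_elim
      case (elim t)
      then have "of_int a * f t + of_int b = (of_int a + of_int b * inverse (f t)) * f t"
        "of_int c * f t + of_int d = (of_int c + of_int d * inverse (f t)) * f t"
        by (simp_all add: field_simps)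
      then show ?case using elim unfolding A moebius_mx by simp
    qed
    ultimately have "((\<lambda>t. moebius A (f t)) \<longlongrightarrow> of_int a / of_int c) F"
      using tendsto_cong by force
    then show ?thesis unfolding tends_to_cusp_def
      by (intro disjI1 bexI[of _ "of_int a / of_int c"]) auto
  qed
qed

lemma moebius_at_rational:
  assumes det: "det A = 1" and q: "q \<in> \<rat>" and f: "(f \<longlongrightarrow> complex_of_real q) F"
    and H: "\<And>t. f t \<in> H2"
  shows "tends_to_cusp (\<lambda>t. moebius A (f t)) F"
proof -
  obtain a b c d where A: "A = mx a b c d" by (rule mx_cases)
  have det': "a * d - b * c = 1" using det A by simp
  have num: "((\<lambda>t. of_int a * f t + of_int b) \<longlongrightarrow> of_int a * of_real q + of_int b) F"
    and den: "((\<lambda>t. of_int c * f t + of_int d) \<longlongrightarrow> of_int c * of_real q + of_int d) F"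
    by (intro tendsto_intros f)+
  show ?thesis
  proof (cases "of_int c * q + of_int d = 0")
    case False
    have "of_int c * of_real q + of_int d = complex_of_real (of_int c * q + of_int d)" by simp
    then have "of_int c * of_real q + of_int d \<noteq> (0::complex)" using False by (metis of_real_eq_0_iff)
    then have "((\<lambda>t. moebius A (f t)) \<longlongrightarrow> (of_int a * of_real q + of_int b) / (of_int c * of_real q + of_int d)) F"
      unfolding A moebius_mx by (intro tendsto_divide num den)
    also have "(of_int a * of_real q + of_int b) / (of_int c * of_real q + of_int d)
        = complex_of_real ((of_int a * q + of_int b) / (of_int c * q + of_int d))" by simp
    finally show ?thesis unfolding tends_to_cusp_def using q
      by (intro disjI1 bexI[of _ "(of_int a * q + of_int b) / (of_int c * q + of_int d)"]) auto
  next
    case True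
    have "of_int c * of_real q + of_int d = complex_of_real (of_int c * q + of_int d)" by simp
    then have 0: "of_int c * of_real q + of_int d = (0::complex)" using True by simp
    have "of_int a * q + of_int b \<noteq> 0"
    proof
      assume *: "of_int a * q + of_int b = 0"
      have "real_of_int 1 = of_int a * (of_int d + of_int c * q) - of_int c * (of_int a * q + of_int b)"
        unfolding det'[symmetric] by (simp add: algebra_simps)
      then show False using * True by (simp add: add.commute)
    qed
    moreover have "of_int a * of_real q + of_int b = complex_of_real (of_int a * q + of_int b)" by simp
    ultimately have nz: "of_int a * of_real q + of_int b \<noteq> (0::complex)" by (metis of_real_eq_0_iff)
    have "filterlim (\<lambda>t. of_int c * f t + of_int d) (at 0) F"
      using den denom_nonzero[OF det'] H unfolding 0 by (intro filterlim_atI) (auto simp: H2_def)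
    then have "filterlim (\<lambda>t. inverse (of_int c * f t + of_int d)) at_infinity F"
      by (rule filterlim_compose[OF filterlim_inverse_at_infinity])
    then have "filterlim (\<lambda>t. moebius A (f t)) at_infinity F"
      unfolding A moebius_mx divide_inverse by (rule tendsto_mult_filterlim_at_infinity[OF num nz])
    then show ?thesis by (simp add: tends_to_cusp_def)
  qed
qed

lemma both_ends_in_cusp_vertical:
  "both_ends_in_cusp (torus_proj \<circ> vertical_geodesic x) \<longleftrightarrow> x \<in> \<rat>"
proof
  assume "both_ends_in_cusp (torus_proj \<circ> vertical_geodesic x)"
  moreover have "is_lift (vertical_geodesic x) (torus_proj \<circ> vertical_geodesic x)"
    using continuous_vertical vertical_in_H2 by (auto simp: is_lift_def)
  ultimately have "tends_to_cusp (vertical_geodesic x) at_bot"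
    unfolding both_ends_in_cusp_def by blast
  moreover have "\<not> filterlim (vertical_geodesic x) at_infinity at_bot"
    using not_tendsto_and_filterlim_at_infinity[OF _ vertical_at_bot] by auto
  ultimately obtain q where "q \<in> \<rat>" "(vertical_geodesic x \<longlongrightarrow> complex_of_real q) at_bot"
    unfolding tends_to_cusp_def by blast
  then show "x \<in> \<rat>" using tendsto_unique[OF _ vertical_at_bot] by fastforce
next
  assume x: "x \<in> \<rat>"
  show "both_ends_in_cusp (torus_proj \<circ> vertical_geodesic x)"
    unfolding both_ends_in_cusp_def
  proof (intro allI impI)
    fix \<gamma> assume "is_lift \<gamma> (torus_proj \<circ> vertical_geodesic x)"
    then have "continuous_on UNIV \<gamma>" "range \<gamma> \<subseteq> H2"
      "torus_proj \<circ> \<gamma> = torus_proj \<circ> vertical_geodesic x" by (auto simp: is_lift_def)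
    then obtain A where A: "A \<in> comm_matrices" "\<And>t. \<gamma> t = moebius A (vertical_geodesic x t)"
      using lift_unique[OF _ _ continuous_vertical, of \<gamma> x] vertical_in_H2 by blast
    then have "det A = 1" "\<gamma> = (\<lambda>t. moebius A (vertical_geodesic x t))" by (auto simp: comm_matrices_def)
    then show "tends_to_cusp \<gamma> at_bot \<and> tends_to_cusp \<gamma> at_top"
      using moebius_at_rational[OF _ x vertical_at_bot] moebius_at_infinity[OF _ vertical_at_top]
        vertical_in_H2 by blast
  qed
qed

section \<open>Simplicity of vertical geodesics\<close>

text \<open>
  A simple vertical geodesic is injective: if it passed through a point at times \<open>s \<noteq> t\<close>, it would
  be periodic, but at large heights only translations identify points, and those preserve heights.
\<close>

lemma simple_vertical_iff:
  "simple_torus_geodesic (torus_proj \<circ> vertical_geodesic x) \<longleftrightarrow>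
    (\<forall>A\<in>comm_matrices. \<forall>s t. moebius A (vertical_geodesic x s) = vertical_geodesic x t \<longrightarrow> A = mat 1 \<or> A = - mat 1)"
  (is "?L \<longleftrightarrow> ?R")
proof
  assume ?R
  have "s = t" if eq: "torus_proj (vertical_geodesic x s) = torus_proj (vertical_geodesic x t)" for s t
  proof -
    obtain A where A: "A \<in> comm_matrices" "moebius A (vertical_geodesic x s) = vertical_geodesic x t"
      using eq torus_proj_eq_iff vertical_in_H2 by metis
    with \<open>?R\<close> have "A = mat 1 \<or> A = - mat 1" by blast
    with A have "vertical_geodesic x s = vertical_geodesic x t" by auto
    then show "s = t" by (simp add: vertical_geodesic_def)
  qed
  then show ?L using torus_geodesic_vertical by (auto simp: simple_torus_geodesic_def)
next
  assume L: ?L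
  show ?R
  proof (intro ballI allI impI)
    fix A s t assume A: "A \<in> comm_matrices" and eq: "moebius A (vertical_geodesic x s) = vertical_geodesic x t"
    have "torus_proj (vertical_geodesic x s) = torus_proj (vertical_geodesic x t)"
      using A eq torus_proj_eq_iff[OF vertical_in_H2 vertical_in_H2] by metis
    with L have *: "torus_proj (vertical_geodesic x (s + u)) = torus_proj (vertical_geodesic x (t + u))" for u
      unfolding simple_torus_geodesic_def comp_apply by blast
    \<comment> \<open>A shift that brings both points above height 1.\<close>
    define u where "u = 1 + \<bar>s\<bar> + \<bar>t\<bar>"
    obtain B where B: "B \<in> comm_matrices"
      "moebius B (vertical_geodesic x (s + u)) = vertical_geodesic x (t + u)"
      using *[of u] torus_proj_eq_iff vertical_in_H2 by metis
    obtain a b c d where Bm: "B = mx a b c d" by (rule mx_cases)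
    have det: "a * d - b * c = 1" using B Bm by (simp add: comm_matrices_def)
    define z where "z = vertical_geodesic x (s + u)"
    define m where "m = of_int c * z + of_int d"
    have Imz: "Im z = exp (s + u)" by (simp add: z_def vertical_geodesic_def)
    have "exp (t + u) = Im (moebius B z)"
      unfolding z_def B(2) by (simp add: vertical_geodesic_def)
    also have "\<dots> = exp (s + u) / (cmod m)\<^sup>2"
      unfolding Bm m_def Imz[symmetric] by (rule Im_moebius_mx[OF det])
    finally have eq2: "exp (t + u) * (cmod m)\<^sup>2 = exp (s + u)"
      using denom_nonzero[OF det, of z] by (simp add: Imz m_def field_simps)
    have big: "exp (t + u) > 1" "exp (s + u) > 1" by (auto simp: u_def)
    have "c = 0"
    proof (rule ccontr)
      assume "c \<noteq> 0"
      then have "1 * exp (s + u) \<le> \<bar>of_int c\<bar> * exp (s + u)" by (intro mult_right_mono) auto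
      also have "\<dots> = \<bar>Im m\<bar>" by (simp add: m_def Imz abs_mult)
      also have "\<dots> \<le> cmod m" by (rule abs_Im_le_cmod)
      finally have "exp (s + u) \<le> cmod m" by simp
      moreover from this have "1 * cmod m \<le> cmod m * cmod m"
        using big by (intro mult_right_mono) linarith+
      ultimately have "exp (s + u) \<le> (cmod m)\<^sup>2" by (simp add: power2_eq_square)
      moreover have "1 * (cmod m)\<^sup>2 < exp (t + u) * (cmod m)\<^sup>2"
        using big \<open>exp (s + u) \<le> (cmod m)\<^sup>2\<close> by (intro mult_strict_right_mono) linarith+
      ultimately show False using eq2 by linarith
    qed
    then have "a * d = 1" using det by simp
    then have "cmod m = 1" using \<open>c = 0\<close> by (auto simp: m_def zmult_eq_1_iff)
    then have "s = t" using eq2 by simp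
    then show "A = mat 1 \<or> A = - mat 1" using comm_matrices_free[OF A vertical_in_H2] eq by metis
  qed
qed

text \<open>
  For \<open>x = p / q\<close> the matrix \<open>A\<close> carries the vertical geodesic to the one with ideal endpoints
  \<open>A \<infinity>\<close> and \<open>A x\<close>. The form \<open>(r, s) \<mapsto> s (q r - p s)\<close> is positive, negative or zero according to
  whether \<open>r / s\<close> lies to the right of \<open>x\<close>, to the left of \<open>x\<close>, or in \<open>{x, \<infinity>}\<close>.
\<close>

definition side :: "int \<Rightarrow> int \<Rightarrow> int \<Rightarrow> int \<Rightarrow> int" where
  "side p q r s = s * (q * r - p * s)"

lemma moebius_vertical_iff:
  assumes q: "q > 0" and det: "a * d - b * c = 1"
  shows "(\<exists>t. moebius (mx a b c d) (vertical_geodesic (of_int p / of_int q) s)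
            = vertical_geodesic (of_int p / of_int q) t) \<longleftrightarrow>
    of_int (side p q (a * p + b * q) (c * p + d * q)) + (of_int q * exp s)\<^sup>2 * of_int (side p q a c) = (0::real)"
    (is "?L \<longleftrightarrow> ?R")
proof -
  define x y where "x = real_of_int p / of_int q" and "y = exp s"
  define z where "z = Complex x y"
  define w where "w = moebius (mx a b c d) z"
  have y: "y > 0" by (simp add: y_def)
  define M where "M = (of_int c * x + of_int d)\<^sup>2 + (of_int c * y)\<^sup>2"
  have M: "M = (cmod (of_int c * z + of_int d))\<^sup>2"
    by (simp add: M_def cmod_power2 z_def)
  then have M0: "M > 0" using denom_nonzero[OF det, of z] y by (simp add: z_def)
  have Rew: "Re w = ((of_int a * x + of_int b) * (of_int c * x + of_int d) + of_int a * of_int c * y\<^sup>2) / M"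
    unfolding w_def moebius_mx by (simp add: Re_divide M_def z_def power2_eq_square algebra_simps)
  have "Im w > 0" using moebius_H2[of "mx a b c d" z] det y by (simp add: w_def H2_def z_def)
  have "?L \<longleftrightarrow> (\<exists>t. w = Complex x (exp t))"
    by (simp add: vertical_geodesic_def x_def w_def z_def y_def)
  also have "\<dots> \<longleftrightarrow> Re w = x"
  proof
    assume "Re w = x"
    then have "w = Complex x (exp (ln (Im w)))" using \<open>Im w > 0\<close> by (simp add: complex_eq_iff)
    then show "\<exists>t. w = Complex x (exp t)" by blast
  qed auto
  also have "\<dots> \<longleftrightarrow> (of_int a * x + of_int b) * (of_int c * x + of_int d) + of_int a * of_int c * y\<^sup>2 - x * M = 0"
    using M0 unfolding Rew by (simp add: field_simps)
  also have "(of_int a * x + of_int b) * (of_int c * x + of_int d) + of_int a * of_int c * y\<^sup>2 - x * M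
     = (of_int (side p q (a * p + b * q) (c * p + d * q)) + (of_int q * y)\<^sup>2 * of_int (side p q a c)) / of_int q ^ 3"
  proof -
    have "p = x * of_int q" using q by (simp add: x_def)
    then show ?thesis using q by (simp add: side_def M_def field_simps power2_eq_square power3_eq_cube)
  qed
  also have "\<dots> = 0 \<longleftrightarrow> ?R" using q by (simp add: y_def)
  finally show ?thesis .
qed

section \<open>Rational Markov triples and their half-turns\<close>

definition rational_triple :: "int \<Rightarrow> int \<Rightarrow> int \<Rightarrow> int \<Rightarrow> int \<Rightarrow> int \<Rightarrow> bool" where
  "rational_triple p1 q1 p2 q2 p3 q3 \<longleftrightarrow>
     markov_triple q1 q2 q3 \<and> p2 * q1 - p1 * q2 = q3 \<and> p3 * q2 - p2 * q3 = q1"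

text \<open>
  The gaps between \<open>x1, x2, x3, x1 + 3\<close> are \<open>q3 / (q1 q2)\<close>, \<open>q1 / (q2 q3)\<close> and \<open>q2 / (q1 q3)\<close>; their
  sum is 3 by the Markov equation.
\<close>

lemma rational_triple_third:
  assumes "rational_triple p1 q1 p2 q2 p3 q3" shows "p3 * q1 - p1 * q3 = 3 * q1 * q3 - q2"
proof -
  have m: "q1\<^sup>2 + q2\<^sup>2 + q3\<^sup>2 = 3 * q1 * q2 * q3" "q2 > 0"
    and d: "p2 * q1 - p1 * q2 = q3" "p3 * q2 - p2 * q3 = q1"
    using assms by (auto simp: rational_triple_def markov_triple_def)
  have "q2 * (p3 * q1 - p1 * q3) = q2 * (3 * q1 * q3 - q2)"
    using m(1) d by algebra
  then show ?thesis using m(2) by simp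
qed

lemma markov_flip:
  assumes "markov_triple a b c" shows "markov_triple a (3 * a * b - c) b"
proof -
  have m: "a\<^sup>2 + b\<^sup>2 + c\<^sup>2 = 3 * a * b * c" "a > 0" "b > 0" "c > 0"
    using assms by (auto simp: markov_triple_def)
  have "c * (3 * a * b - c) = a\<^sup>2 + b\<^sup>2" using m(1) by algebra
  also have "\<dots> > 0" using m(2) by (simp add: add_pos_nonneg)
  finally have "3 * a * b - c > 0" using m(4) by (simp add: zero_less_mult_iff)
  moreover have "a\<^sup>2 + (3 * a * b - c)\<^sup>2 + b\<^sup>2 = 3 * a * (3 * a * b - c) * b" using m(1) by algebra
  ultimately show ?thesis using m by (simp add: markov_triple_def)
qed

lemma markov_commute:
  "markov_triple a b c \<Longrightarrow> markov_triple b a c" "markov_triple a b c \<Longrightarrow> markov_triple a c b"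
  by (auto simp: markov_triple_def algebra_simps)

text \<open>
  Flipping an edge of the triangulation replaces the vector \<open>v = (p, q)\<close> of one fraction by
  \<open>3 qi vj - v\<close>, where \<open>i\<close> and \<open>j\<close> are the other two indices. On denominators this
  is the Vieta involution of the Markov equation.
\<close>

lemma rational_triple_flip_last:
  assumes "rational_triple p1 q1 p2 q2 p3 q3" shows "rational_triple p1 q1 (3 * q1 * p2 - p3) (3 * q1 * q2 - q3) p2 q2"
proof -
  have m: "markov_triple q1 q2 q3" and D: "p2 * q1 - p1 * q2 = q3" "p3 * q2 - p2 * q3 = q1"
    using assms by (auto simp: rational_triple_def)
  show ?thesis
    unfolding rational_triple_def
  proof (intro conjI)
    show "markov_triple q1 (3 * q1 * q2 - q3) q2" using markov_flip[OF m] .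
    have "(3 * q1 * p2 - p3) * q1 - p1 * (3 * q1 * q2 - q3)
        = 3 * q1 * (p2 * q1 - p1 * q2) - (p3 * q1 - p1 * q3)" by (simp add: algebra_simps)
    then show "(3 * q1 * p2 - p3) * q1 - p1 * (3 * q1 * q2 - q3) = q2"
      unfolding D rational_triple_third[OF assms] by simp
    show "p2 * (3 * q1 * q2 - q3) - (3 * q1 * p2 - p3) * q2 = q1" using D rational_triple_third[OF assms] by (simp add: algebra_simps)
  qed
qed

lemma rational_triple_flip_mid:
  assumes "rational_triple p1 q1 p2 q2 p3 q3" shows "rational_triple p1 q1 p3 q3 (3 * q1 * p3 - p2) (3 * q1 * q3 - q2)"
proof -
  have m: "markov_triple q1 q2 q3" and D: "p2 * q1 - p1 * q2 = q3" "p3 * q2 - p2 * q3 = q1"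
    using assms by (auto simp: rational_triple_def)
  show ?thesis
    unfolding rational_triple_def
  proof (intro conjI)
    show "markov_triple q1 q3 (3 * q1 * q3 - q2)" using markov_commute(2)[OF markov_flip[OF markov_commute(2)[OF m]]] .
    show "p3 * q1 - p1 * q3 = 3 * q1 * q3 - q2" using D rational_triple_third[OF assms] by (simp add: algebra_simps)
    show "(3 * q1 * p3 - p2) * q3 - p3 * (3 * q1 * q3 - q2) = q1" using D rational_triple_third[OF assms] by (simp add: algebra_simps)
  qed
qed

lemma rational_triple_flip_first:
  assumes "rational_triple p1 q1 p2 q2 p3 q3" shows "rational_triple p2 q2 (3 * q3 * p2 - p1) (3 * q3 * q2 - q1) p3 q3"
proof -
  have m: "markov_triple q1 q2 q3" and D: "p2 * q1 - p1 * q2 = q3" "p3 * q2 - p2 * q3 = q1"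
    using assms by (auto simp: rational_triple_def)
  show ?thesis
    unfolding rational_triple_def
  proof (intro conjI)
    show "markov_triple q2 (3 * q3 * q2 - q1) q3" using markov_commute(2)[OF markov_commute(1)[OF markov_commute(2)[OF markov_flip[OF markov_commute(2)[OF markov_commute(1)[OF markov_commute(2)[OF m]]]]]]] .
    show "(3 * q3 * p2 - p1) * q2 - p2 * (3 * q3 * q2 - q1) = q3" using D rational_triple_third[OF assms] by (simp add: algebra_simps)
    have "p3 * (3 * q3 * q2 - q1) - (3 * q3 * p2 - p1) * q3
        = 3 * q3 * (p3 * q2 - p2 * q3) - (p3 * q1 - p1 * q3)" by (simp add: algebra_simps)
    then show "p3 * (3 * q3 * q2 - q1) - (3 * q3 * p2 - p1) * q3 = q2"
      unfolding D rational_triple_third[OF assms] by simp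
  qed
qed

text \<open>
  Triples belong to periodic sequences \<open>x1, x2, x3, x1 + 3, x2 + 3, \<dots>\<close>, so each fraction of a triple
  is the first one of another triple.
\<close>

lemma rational_triple_shift:
  assumes "rational_triple p1 q1 p2 q2 p3 q3" shows "rational_triple p2 q2 p3 q3 (p1 + 3 * q1) q1"
proof -
  have m: "markov_triple q1 q2 q3" and D: "p2 * q1 - p1 * q2 = q3" "p3 * q2 - p2 * q3 = q1"
    using assms by (auto simp: rational_triple_def)
  show ?thesis
    unfolding rational_triple_def
  proof (intro conjI)
    show "markov_triple q2 q3 q1" using markov_commute(2)[OF markov_commute(1)[OF m]] .
    show "p3 * q2 - p2 * q3 = q1" using D rational_triple_third[OF assms] by (simp add: algebra_simps)
    show "(p1 + 3 * q1) * q3 - p3 * q1 = q2" using D rational_triple_third[OF assms] by (simp add: algebra_simps)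
  qed
qed

lemma rational_triple_integers: "rational_triple n 1 (n + 1) 1 (n + 2) 1"
  by (simp add: rational_triple_def markov_triple_def)

lemma markov_fraction_iff:
  "markov_fraction x \<longleftrightarrow> (\<exists>p1 q1 p2 q2 p3 q3. rational_triple p1 q1 p2 q2 p3 q3 \<and> x = of_int p1 / of_int q1)"
proof
  assume "markov_fraction x"
  then obtain p1 q1 p2 q2 p3 q3 where r: "rational_triple p1 q1 p2 q2 p3 q3"
    and x: "x \<in> {of_int p1 / of_int q1, of_int p2 / of_int q2, of_int p3 / of_int q3}"
    unfolding markov_fraction_def rational_markov_triple_def rational_triple_def by blast
  from x r rational_triple_shift[OF r] rational_triple_shift[OF rational_triple_shift[OF r]]
  show "\<exists>p1 q1 p2 q2 p3 q3. rational_triple p1 q1 p2 q2 p3 q3 \<and> x = of_int p1 / of_int q1" by blast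
next
  assume "\<exists>p1 q1 p2 q2 p3 q3. rational_triple p1 q1 p2 q2 p3 q3 \<and> x = of_int p1 / of_int q1"
  then show "markov_fraction x"
    unfolding markov_fraction_def rational_markov_triple_def rational_triple_def by blast
qed

text \<open>
  If \<open>q\<close> divides \<open>p\<^sup>2 + 1\<close>, this is the rotation by \<open>\<pi>\<close> around the point at height
  \<open>1 / q\<close> above \<open>p / q\<close>, which exchanges \<open>\<infinity>\<close> and \<open>p / q\<close>.
\<close>

definition half_turn :: "int \<Rightarrow> int \<Rightarrow> int^2^2" where
  "half_turn p q = mx p (- ((p\<^sup>2 + 1) div q)) q (- p)"

lemma half_turn_props:
  assumes "q dvd p\<^sup>2 + 1"
  obtains b where "half_turn p q = mx p (- b) q (- p)" "q * b = p\<^sup>2 + 1"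
  using assms unfolding half_turn_def by (metis dvd_mult_div_cancel)

lemma half_turn_square: "q dvd p\<^sup>2 + 1 \<Longrightarrow> half_turn p q ** half_turn p q = - mat 1"
  by (elim half_turn_props) (simp add: mx_one algebra_simps power2_eq_square)

lemma det_half_turn: "q dvd p\<^sup>2 + 1 \<Longrightarrow> det (half_turn p q) = 1"
  by (elim half_turn_props) (simp add: algebra_simps power2_eq_square)

lemma chi_half_turn:
  assumes "q dvd p\<^sup>2 + 1" shows "6 dvd chi (half_turn p q) - 3"
proof -
  have det: "det (half_turn p q) = 1" by (rule det_half_turn[OF assms])
  have "chi (- mat 1) = 6" by (simp add: mx_one)
  then have "6 dvd 6 - (chi (half_turn p q) + chi (half_turn p q))"
    using chi_mult[OF det det] half_turn_square[OF assms] by simp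
  moreover have "odd (chi (half_turn p q))"
    by (rule odd_chi_of_trace_zero[OF det]) (simp add: half_turn_def)
  ultimately show ?thesis by presburger
qed

text \<open>
  When an edge is flipped, the half-turn around the new edge is the conjugate of the half-turn around
  the old one by another half-turn of the triple. The square in \<open>D\<close> leaves the order of the two
  fractions open, so that one computation covers all flips. It also shows that divisibility of
  \<open>p\<^sup>2 + 1\<close> by \<open>q\<close> is inherited.
\<close>

lemma half_turn_flip:
  assumes "q > 0" "q' > 0" "q dvd p\<^sup>2 + 1" "q' dvd p'\<^sup>2 + 1"
    and D: "(q * p' - p * q')\<^sup>2 = m\<^sup>2" and m: "q\<^sup>2 + m\<^sup>2 + q'\<^sup>2 = 3 * m * q * q'"
  shows "(3 * m * q - q') dvd (3 * m * p - p')\<^sup>2 + 1 \<and>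
    half_turn (3 * m * p - p') (3 * m * q - q') = - (half_turn p q ** half_turn p' q' ** half_turn p q)"
proof -
  obtain b where b: "half_turn p q = mx p (- b) q (- p)" "q * b = p\<^sup>2 + 1"
    by (rule half_turn_props[OF assms(3)])
  obtain b' where b': "half_turn p' q' = mx p' (- b') q' (- p')" "q' * b' = p'\<^sup>2 + 1"
    by (rule half_turn_props[OF assms(4)])
  define N where "N = half_turn p q ** half_turn p' q' ** half_turn p q"
  define X where "X = (p * p' - b * q') * p + (b * p' - p * b') * q"
  define Y where "Y = - ((p * p' - b * q') * b + (b * p' - p * b') * p)"
  define Z where "Z = (q * p' - p * q') * p + (p * p' - q * b') * q"
  have N: "N = mx X Y Z (- X)"
    unfolding N_def b b' X_def Y_def Z_def by (simp add: algebra_simps)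
  have "q' * Z = (q * p' - p * q') * p * q' + (p * p' * q' - q * (q' * b')) * q"
    unfolding Z_def by (simp add: algebra_simps)
  also have "\<dots> = - ((q * p' - p * q')\<^sup>2 + q\<^sup>2)"
    unfolding b'(2) by (simp add: algebra_simps power2_eq_square)
  also have "\<dots> = q' * (q' - 3 * m * q)"
    using m unfolding D by (simp add: algebra_simps power2_eq_square)
  finally have "q' * Z = q' * (q' - 3 * m * q)" .
  then have Z': "Z = q' - 3 * m * q" using assms(2) by simp
  have "q * X - p * Z = (q * b) * (q * p' - p * q') - p\<^sup>2 * (q * p' - p * q')"
    unfolding X_def Z_def by (simp add: algebra_simps power2_eq_square)
  also have "\<dots> = q * p' - p * q'" unfolding b(2) by (simp add: algebra_simps)
  finally have "q * X = q * (p' - 3 * m * p)" unfolding Z' by (simp add: algebra_simps)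
  then have X': "X = p' - 3 * m * p" using assms(1) by simp
  have "det N = 1" unfolding N_def det_mul using assms by (simp add: det_half_turn)
  then have *: "(3 * m * q - q') * Y = (3 * m * p - p')\<^sup>2 + 1"
    unfolding N X' Z' by (simp add: power2_eq_square algebra_simps)
  have nz: "3 * m * q - q' \<noteq> 0"
  proof
    assume "3 * m * q - q' = 0"
    with * have "(3 * m * p - p')\<^sup>2 + 1 = 0" by simp
    then show False using zero_le_power2[of "3 * m * p - p'"] by linarith
  qed
  have "((3 * m * p - p')\<^sup>2 + 1) div (3 * m * q - q') = Y" using nz by (simp flip: *)
  then show ?thesis
    unfolding N_def[symmetric] N X' Z' using dvdI[OF *[symmetric]] by (simp add: half_turn_def)
qed

text \<open>
  Products of elements of \<open>S\<close>, up to sign. Inverses are omitted because half-turns are their own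
  inverses up to sign.
\<close>

inductive_set words :: "(int^2^2) set \<Rightarrow> (int^2^2) set" for S where
  one: "mat 1 \<in> words S"
| neg: "A \<in> words S \<Longrightarrow> - A \<in> words S"
| mult: "G \<in> S \<Longrightarrow> A \<in> words S \<Longrightarrow> G ** A \<in> words S"

lemma words_mult:
  assumes "A \<in> words S" "B \<in> words S" shows "A ** B \<in> words S"
  using assms(1)
proof induction
  case (mult G A)
  then show ?case using words.mult[of G S "A ** B"] by (simp add: matrix_mul_assoc)
qed (use assms(2) words.neg in auto)

lemma words_incl: "G \<in> S \<Longrightarrow> G \<in> words S"
  using words.mult[OF _ words.one] by force

lemma words_subset:
  assumes "S \<subseteq> words S'" shows "words S \<subseteq> words S'"
proof
  fix A assume "A \<in> words S"
  then show "A \<in> words S'"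
    by induction (use assms in \<open>auto intro: words.intros words_mult\<close>)
qed

definition turns :: "(int \<times> int) set \<Rightarrow> (int^2^2) set" where
  "turns V = (\<lambda>(p, q). half_turn p q) ` V"

text \<open>
  The matrices whose value under \<^const>\<open>chi\<close> is divisible by 3 form the group generated by the commutator
  subgroup and the hyperelliptic involution of the torus. The quotient of the torus by the involution is a
  sphere with a cusp and three cone points of order two, which is why three half-turns
  can generate this group.
\<close>

definition generating :: "(int \<times> int) set \<Rightarrow> bool" where
  "generating V \<longleftrightarrow> (\<forall>(p, q) \<in> V. q dvd p\<^sup>2 + 1) \<and>
     (\<forall>A. det A = 1 \<longrightarrow> 3 dvd chi A \<longrightarrow> A \<in> words (turns V))"

lemma generating_flip:
  assumes g: "generating {(p, q), (p', q'), (pm, m)}" and m: "markov_triple m q q'"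
    and D: "(q * p' - p * q')\<^sup>2 = m\<^sup>2"
  shows "generating {(p, q), (3 * m * p - p', 3 * m * q - q'), (pm, m)}"
proof -
  define p'' q'' where "p'' = 3 * m * p - p'" and "q'' = 3 * m * q - q'"
  have dv: "q dvd p\<^sup>2 + 1" "q' dvd p'\<^sup>2 + 1" "m dvd pm\<^sup>2 + 1" using g by (auto simp: generating_def)
  have mt: "q > 0" "q' > 0" "q\<^sup>2 + m\<^sup>2 + q'\<^sup>2 = 3 * m * q * q'"
    using m by (auto simp: markov_triple_def)
  have f: "q'' dvd p''\<^sup>2 + 1" "half_turn p'' q'' = - (half_turn p q ** half_turn p' q' ** half_turn p q)"
    using half_turn_flip[OF mt(1,2) dv(1,2) D mt(3)] by (simp_all add: p''_def q''_def)
  let ?W = "words (turns {(p, q), (p'', q''), (pm, m)})"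
  have gens: "half_turn p q \<in> ?W" "half_turn p'' q'' \<in> ?W" "half_turn pm m \<in> ?W"
    by (auto intro!: words_incl simp: turns_def)
  have sq: "half_turn p q ** half_turn p q = - mat 1" by (rule half_turn_square[OF dv(1)])
  have "half_turn p q ** half_turn p'' q'' ** half_turn p q
      = - ((half_turn p q ** half_turn p q) ** half_turn p' q' ** (half_turn p q ** half_turn p q))"
    unfolding f(2) by (simp add: matrix_mul_assoc)
  also have "\<dots> = - half_turn p' q'" unfolding sq by simp
  finally have "half_turn p' q' = - (half_turn p q ** half_turn p'' q'' ** half_turn p q)" by simp
  also have "\<dots> \<in> ?W" by (intro words.neg words_mult gens)
  finally have "turns {(p, q), (p', q'), (pm, m)} \<subseteq> ?W" using gens by (simp add: turns_def)
  from words_subset[OF this] show ?thesis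
    using g dv f(1) unfolding p''_def[symmetric] q''_def[symmetric] generating_def by blast
qed

text \<open>
  The half-turns above consecutive integers are conjugate by \<open>T\<close>, and the product of three
  consecutive ones is \<open>T\<^sup>3\<close>. Up to sign they generate a normal subgroup whose cosets are
  represented by powers of \<open>T\<close>.
\<close>

lemma generating_integers: "generating {(n, 1), (n + 1, 1), (n + 2, 1)}"
proof -
  let ?W = "words (turns {(n, 1), (n + 1, 1), (n + 2, 1)})"
  have ht: "half_turn k 1 = mx k (- (k\<^sup>2 + 1)) 1 (- k)" for k by (simp add: half_turn_def)
  have gens: "half_turn n 1 \<in> ?W" "half_turn (n + 1) 1 \<in> ?W" "half_turn (n + 2) 1 \<in> ?W"
    by (auto intro!: words_incl simp: turns_def)
  have "half_turn (n + 2) 1 ** half_turn (n + 1) 1 ** half_turn n 1 = Tpow 3"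
    by (simp add: ht algebra_simps power2_eq_square)
  then have T3: "Tpow 3 \<in> ?W" using gens words_mult by metis
  have "- (half_turn n 1 ** half_turn (n + 1) 1 ** half_turn (n + 2) 1) = Tpow (- 3)"
    by (simp add: ht algebra_simps power2_eq_square)
  then have T3': "Tpow (- 3) \<in> ?W" using gens words_mult words.neg by metis
  have pos: "Tpow (3 * int k) \<in> ?W" for k
  proof (induction k)
    case 0
    then show ?case using words.one by (simp add: mx_one)
  next
    case (Suc k)
    then show ?case using words_mult[OF T3 Suc] by (simp add: algebra_simps)
  qed
  have neg: "Tpow (- (3 * int k)) \<in> ?W" for k
  proof (induction k)
    case 0
    then show ?case using words.one by (simp add: mx_one)
  next
    case (Suc k)
    then show ?case using words_mult[OF T3' Suc] by (simp add: algebra_simps)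
  qed
  have T: "Tpow (3 * k) \<in> ?W" for k
    using pos neg by (cases k rule: int_cases2) auto
  have J: "half_turn k 1 \<in> ?W" for k
  proof -
    define j r where "j = (k - n) div 3" and "r = (k - n) mod 3"
    have k: "k = n + r + 3 * j" by (simp add: j_def r_def)
    have "r = 0 \<or> r = 1 \<or> r = 2" unfolding r_def by presburger
    then have "half_turn (n + r) 1 \<in> ?W" using gens by auto
    then have "Tpow (3 * j) ** half_turn (n + r) 1 ** Tpow (3 * (- j)) \<in> ?W"
      by (intro words_mult T)
    also have "Tpow (3 * j) ** half_turn (n + r) 1 ** Tpow (3 * (- j)) = half_turn k 1"
      unfolding k by (simp add: ht algebra_simps power2_eq_square)
    finally show ?thesis .
  qed
  have "\<exists>B k. det B = 1 \<and> B \<in> ?W \<and> 3 dvd chi B \<and> A = B ** Tpow k" if "det A = 1" for A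
    using that
  proof (induction A rule: SL2Z_induct)
    case one
    have "3 dvd chi (mat 1)" by (simp add: mx_one)
    then show ?case using words.one by (intro exI[of _ "mat 1"] exI[of _ 0]) (simp add: mx_one)
  next
    case (T A n)
    then obtain B k where "det B = 1" "B \<in> ?W" "3 dvd chi B" "A = B ** Tpow k" by blast
    then show ?case
      by (intro exI[of _ B] exI[of _ "k + n"]) (simp flip: matrix_mul_assoc add: add.commute)
  next
    case (S A)
    then obtain B k where B: "det B = 1" "B \<in> ?W" "3 dvd chi B" "A = B ** Tpow k" by blast
    have "A ** Smat = B ** half_turn k 1 ** Tpow k"
      unfolding B(4) by (simp flip: matrix_mul_assoc add: ht algebra_simps power2_eq_square)
    moreover have "B ** half_turn k 1 \<in> ?W" by (intro words_mult B J)
    moreover have "det (B ** half_turn k 1) = 1" using B by (simp add: det_mul det_half_turn)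
    moreover have "3 dvd chi (B ** half_turn k 1)"
    proof -
      have "3 dvd chi (B ** half_turn k 1) - (chi B + chi (half_turn k 1))"
        using chi_mult[of B "half_turn k 1"] B(1) by (auto simp: det_half_turn intro: dvd_trans[of 3 "6::int"])
      moreover have "3 dvd chi (half_turn k 1)" by (simp add: ht)
      ultimately show ?thesis
        using B(3) by (metis dvd_add dvd_diff_right_iff diff_add_cancel)
    qed
    ultimately show ?case by blast
  qed
  moreover have "A \<in> ?W" if A: "3 dvd chi A" "det B = 1" "B \<in> ?W" "3 dvd chi B" "A = B ** Tpow k" for A B k
  proof -
    have "3 dvd chi A - (chi B + k)"
      unfolding A(5) using chi_T[OF A(2)] by (rule dvd_trans[rotated]) simp
    from dvd_diff[OF dvd_diff[OF A(1) this] A(4)] have "3 dvd k" by fastforce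
    then obtain j where "k = 3 * j" by (elim dvdE)
    then show ?thesis unfolding A(5) using A(3) T words_mult by metis
  qed
  ultimately have "A \<in> ?W" if "det A = 1" "3 dvd chi A" for A using that by blast
  then show ?thesis unfolding generating_def by simp
qed

text \<open>
  Markov's descent: the Vieta involution makes the largest entry smaller, except for \<open>(1, 1, 1)\<close>.
  If it did not, then \<open>b\<^sup>2 \<le> a\<^sup>2 + c\<^sup>2\<close>; but the Markov equation gives \<open>a c \<le> b\<close>, so
  \<open>a = 1\<close> or \<open>c = 1\<close>, and then all entries are equal.
\<close>

lemma markov_max_decreases:
  assumes m: "markov_triple a b c" and le: "a \<le> b" "c \<le> b" and ne: "b \<noteq> 1"
  shows "3 * a * c - b < b"
proof (rule ccontr)
  assume "\<not> 3 * a * c - b < b"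
  have eq: "a\<^sup>2 + b\<^sup>2 + c\<^sup>2 = 3 * a * b * c" and pos: "a > 0" "b > 0" "c > 0"
    using m by (auto simp: markov_triple_def)
  have "a\<^sup>2 \<le> b\<^sup>2" "c\<^sup>2 \<le> b\<^sup>2" using le pos by (auto intro: power_mono)
  with eq have "3 * (b * (a * c)) \<le> 3 * (b * b)" by (simp add: power2_eq_square algebra_simps)
  then have acb: "a * c \<le> b" using pos by simp
  have "b * b \<le> b * (3 * a * c - b)" using \<open>\<not> 3 * a * c - b < b\<close> pos by (intro mult_left_mono) auto
  also have "\<dots> = a\<^sup>2 + c\<^sup>2" using eq by (simp add: power2_eq_square algebra_simps)
  finally have bb: "b\<^sup>2 \<le> a\<^sup>2 + c\<^sup>2" by (simp add: power2_eq_square)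
  have "(a * c)\<^sup>2 \<le> b\<^sup>2" using acb pos by (intro power_mono) auto
  with bb have "(a\<^sup>2 - 1) * (c\<^sup>2 - 1) \<le> 1" by (simp add: power_mult_distrib algebra_simps)
  have one: "a = 1 \<or> c = 1"
  proof (rule ccontr)
    assume "\<not> (a = 1 \<or> c = 1)"
    then have "a \<ge> 2" "c \<ge> 2" using pos by auto
    then have "2\<^sup>2 \<le> a\<^sup>2" "2\<^sup>2 \<le> c\<^sup>2" by (intro power_mono; simp)+
    then have "3 * 3 \<le> (a\<^sup>2 - 1) * (c\<^sup>2 - 1)" by (intro mult_mono) auto
    with \<open>(a\<^sup>2 - 1) * (c\<^sup>2 - 1) \<le> 1\<close> show False by simp
  qed
  have *: False if "x\<^sup>2 + b\<^sup>2 + 1 = 3 * x * b" "b\<^sup>2 \<le> x\<^sup>2 + 1" "0 < x" "x \<le> b" for x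
  proof (cases "x = b")
    case True
    with that(1) have "b\<^sup>2 = 1" by (simp add: power2_eq_square)
    then show False using pos ne by (auto simp: power2_eq_1_iff)
  next
    case False
    then have "(x + 1)\<^sup>2 \<le> b\<^sup>2" using that by (intro power_mono) auto
    then show False using that(2,3) by (simp add: power2_eq_square algebra_simps)
  qed
  show False using one *[of a] *[of c] eq bb le pos by (auto simp: algebra_simps)
qed

lemma rational_triple_generating:
  assumes "rational_triple p1 q1 p2 q2 p3 q3" shows "generating {(p1, q1), (p2, q2), (p3, q3)}"
  using assms
proof (induction "nat (q1 + q2 + q3)" arbitrary: p1 q1 p2 q2 p3 q3 rule: less_induct)
  case less
  note r = less.prems
  have m: "markov_triple q1 q2 q3" and D: "p2 * q1 - p1 * q2 = q3" "p3 * q2 - p2 * q3 = q1"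
    using r by (auto simp: rational_triple_def)
  have pos: "q1 > 0" "q2 > 0" "q3 > 0" using m by (auto simp: markov_triple_def)
  consider "q1 = 1" "q2 = 1" "q3 = 1" | "q1 \<le> q2" "q3 \<le> q2" "q2 \<noteq> 1"
    | "q1 \<le> q3" "q2 \<le> q3" "q3 \<noteq> 1" | "q2 \<le> q1" "q3 \<le> q1" "q1 \<noteq> 1"
    using pos by linarith
  then show ?case
  proof cases
    case 1
    then have "p2 = p1 + 1" "p3 = p1 + 2" using D by auto
    then show ?thesis using 1 generating_integers by simp
  next
    case 2
    have r': "rational_triple p1 q1 p3 q3 (3 * q1 * p3 - p2) (3 * q1 * q3 - q2)" by (rule rational_triple_flip_mid[OF r])
    have "3 * q1 * q3 - q2 < q2" by (rule markov_max_decreases[OF m 2])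
    then have g: "generating {(p1, q1), (p3, q3), (3 * q1 * p3 - p2, 3 * q1 * q3 - q2)}"
      using pos by (intro less.hyps[OF _ r']) auto
    have "generating {(p3, q3), (3 * q1 * p3 - (3 * q1 * p3 - p2), 3 * q1 * q3 - (3 * q1 * q3 - q2)), (p1, q1)}"
    proof (rule generating_flip)
      show "generating {(p3, q3), (3 * q1 * p3 - p2, 3 * q1 * q3 - q2), (p1, q1)}"
        using g by (simp add: insert_commute)
      show "markov_triple q1 q3 (3 * q1 * q3 - q2)" using r' by (simp add: rational_triple_def)
      show "(q3 * (3 * q1 * p3 - p2) - p3 * (3 * q1 * q3 - q2))\<^sup>2 = q1\<^sup>2"
        unfolding D(2)[symmetric] by algebra
    qed
    then show ?thesis by (simp add: insert_commute)
  next
    case 3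
    have r': "rational_triple p1 q1 (3 * q1 * p2 - p3) (3 * q1 * q2 - q3) p2 q2" by (rule rational_triple_flip_last[OF r])
    have "3 * q1 * q2 - q3 < q3" by (rule markov_max_decreases[OF markov_commute(2)[OF m] 3])
    then have g: "generating {(p1, q1), (3 * q1 * p2 - p3, 3 * q1 * q2 - q3), (p2, q2)}"
      using pos by (intro less.hyps[OF _ r']) auto
    have "generating {(p2, q2), (3 * q1 * p2 - (3 * q1 * p2 - p3), 3 * q1 * q2 - (3 * q1 * q2 - q3)), (p1, q1)}"
    proof (rule generating_flip)
      show "generating {(p2, q2), (3 * q1 * p2 - p3, 3 * q1 * q2 - q3), (p1, q1)}"
        using g by (simp add: insert_commute)
      show "markov_triple q1 q2 (3 * q1 * q2 - q3)" using r' markov_commute(2) by (simp add: rational_triple_def)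
      show "(q2 * (3 * q1 * p2 - p3) - p2 * (3 * q1 * q2 - q3))\<^sup>2 = q1\<^sup>2"
        unfolding D(2)[symmetric] by algebra
    qed
    then show ?thesis by (simp add: insert_commute)
  next
    case 4
    have r': "rational_triple p2 q2 (3 * q3 * p2 - p1) (3 * q3 * q2 - q1) p3 q3" by (rule rational_triple_flip_first[OF r])
    have "3 * q2 * q3 - q1 < q1"
      by (rule markov_max_decreases[OF markov_commute(1)[OF m] 4])
    then have g: "generating {(p2, q2), (3 * q3 * p2 - p1, 3 * q3 * q2 - q1), (p3, q3)}"
      using pos by (intro less.hyps[OF _ r']) (auto simp: algebra_simps)
    have "generating {(p2, q2), (3 * q3 * p2 - (3 * q3 * p2 - p1), 3 * q3 * q2 - (3 * q3 * q2 - q1)), (p3, q3)}"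
    proof (rule generating_flip[OF g])
      show "markov_triple q3 q2 (3 * q3 * q2 - q1)"
        using r' markov_commute unfolding rational_triple_def by blast
      show "(q2 * (3 * q3 * p2 - p1) - p2 * (3 * q3 * q2 - q1))\<^sup>2 = q3\<^sup>2"
        unfolding D(1)[symmetric] by algebra
    qed
    then show ?thesis by (simp add: insert_commute)
  qed
qed

section \<open>Markov fractions give simple geodesics\<close>

text \<open>Products of letters \<open>g k\<close>, up to sign, with distinct neighbours; the index is the first letter.\<close>

inductive reduced :: "('i \<Rightarrow> int^2^2) \<Rightarrow> 'i set \<Rightarrow> 'i \<Rightarrow> int^2^2 \<Rightarrow> bool" for g K where
  letter: "k \<in> K \<Longrightarrow> reduced g K k (g k)"
| cons: "j \<in> K \<Longrightarrow> reduced g K k A \<Longrightarrow> j \<noteq> k \<Longrightarrow> reduced g K j (g j ** A)"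
| neg: "reduced g K k A \<Longrightarrow> reduced g K k (- A)"

lemma reduced_in: "reduced g K k A \<Longrightarrow> k \<in> K"
  by (induction rule: reduced.induct)

lemma reduced_cancel:
  assumes "reduced g K k A" and inv: "\<And>k. k \<in> K \<Longrightarrow> g k ** g k = - mat 1"
  shows "g k ** A = mat 1 \<or> g k ** A = - mat 1 \<or> (\<exists>j. reduced g K j (g k ** A))"
  using assms(1)
proof induction
  case (letter k)
  then show ?case by (simp add: inv)
next
  case (cons j k A)
  have "g j ** (g j ** A) = - A" using cons by (simp add: inv matrix_mul_assoc)
  then show ?case using reduced.neg[OF cons.hyps(2)] by auto
next
  case (neg k A)
  then show ?case using reduced.neg[of g K _ "g k ** A"] by (auto simp: minus_equation_iff)
qed

lemma words_reduced:
  assumes "A \<in> words (g ` K)" and inv: "\<And>k. k \<in> K \<Longrightarrow> g k ** g k = - mat 1"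
  shows "A = mat 1 \<or> A = - mat 1 \<or> (\<exists>k. reduced g K k A)"
  using assms(1)
proof induction
  case one
  then show ?case by simp
next
  case (neg A)
  then show ?case using reduced.neg by fastforce
next
  case (mult G A)
  then obtain k where k: "k \<in> K" "G = g k" by blast
  from mult.IH show ?case
  proof (elim disjE exE)
    fix j assume j: "reduced g K j A"
    show ?case
    proof (cases "k = j")
      case True
      then show ?thesis using reduced_cancel[OF j inv] k by blast
    next
      case False
      then show ?thesis using reduced.cons[OF k(1) j] k by blast
    qed
  qed (use k reduced.letter[of k K g] reduced.neg[of g K k "g k"] in auto)
qed

text \<open>
  The closed arcs \<open>F k \<ge> 0\<close> have disjoint interiors and the involution \<open>g k\<close> exchanges
  the \<open>k\<close>-th arc with its complement. A reduced word therefore carries a point outside all open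
  arcs into the arc of its first letter.
\<close>

lemma ping_pong:
  fixes F :: "'i \<Rightarrow> int^2 \<Rightarrow> int"
  assumes "reduced g K k A"
    and swap: "\<And>k w. k \<in> K \<Longrightarrow> F k (g k *v w) = - F k w"
    and disj: "\<And>j k w. j \<in> K \<Longrightarrow> k \<in> K \<Longrightarrow> j \<noteq> k \<Longrightarrow> F k w \<ge> 0 \<Longrightarrow> F j w \<le> 0"
    and even: "\<And>k w. F k (- w) = F k w"
    and start: "\<And>k. k \<in> K \<Longrightarrow> F k w \<le> 0"
  shows "F k (A *v w) \<ge> 0"
  using assms(1)
proof induction
  case (letter k)
  then show ?case using swap start by simp
next
  case (cons j k A)
  have "F j (A *v w) \<le> 0" using disj[OF _ reduced_in[OF cons.hyps(2)]] cons by blast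
  then show ?case using swap cons.hyps by (simp flip: matrix_vector_mul_assoc)
next
  case (neg k A)
  have "(- A) *v w = - (A *v w)"
    by (simp add: vec_eq_iff matrix_vector_mult_def sum_negf)
  then show ?case using neg even by simp
qed

lemma mx_mult_vec [simp]:
  "(mx a b c d *v w) $ 1 = a * w$1 + b * w$2" "(mx a b c d *v w) $ 2 = c * w$1 + d * w$2"
  by (simp_all add: matrix_vector_mult_def sum_2)

text \<open>
  The half-turns of a triple exchange the two sides of the edges of the ideal triangle with vertices
  \<open>\<infinity>, x1, x3\<close>; the half-turn around the edge from \<open>x1\<close> to \<open>x3\<close> is the one that
  exchanges \<open>\<infinity>\<close> and \<open>x2\<close>. Each form is nonnegative on the closed arc that the respective
  edge separates from the triangle.
\<close>

definition arc_form :: "int \<Rightarrow> int \<Rightarrow> int \<Rightarrow> int \<Rightarrow> nat \<Rightarrow> int^2 \<Rightarrow> int" where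
  "arc_form p1 q1 p3 q3 k w =
    (if k = 1 then - side p1 q1 (w$1) (w$2)
     else if k = 2 then - ((q1 * w$1 - p1 * w$2) * (q3 * w$1 - p3 * w$2))
     else side p3 q3 (w$1) (w$2))"

lemma half_turn_side:
  assumes "q dvd p\<^sup>2 + 1" 
  shows "side p q ((half_turn p q *v w) $ 1) ((half_turn p q *v w) $ 2) = - side p q (w$1) (w$2)"
proof -
  obtain b where b: "half_turn p q = mx p (- b) q (- p)" "q * b = p\<^sup>2 + 1"
    by (rule half_turn_props[OF assms])
  have "q * (p * w$1 + - b * w$2) - p * (q * w$1 + - p * w$2) = - (q * b - p\<^sup>2) * w$2"
    by (simp add: algebra_simps power2_eq_square)
  also have "\<dots> = - w$2" using b(2) by simp
  finally have eq: "q * (p * w$1 + - b * w$2) - p * (q * w$1 + - p * w$2) = - w$2" .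
  show ?thesis unfolding b(1) mx_mult_vec side_def eq by (simp add: algebra_simps)
qed

lemma half_turn_opposite:
  fixes w :: "int^2"
  assumes r: "rational_triple p1 q1 p2 q2 p3 q3" and dv: "q2 dvd p2\<^sup>2 + 1"
  defines "w' \<equiv> half_turn p2 q2 *v w"
  shows "q1 * w'$1 - p1 * w'$2 = q3 * w$1 - p3 * w$2" "q3 * w'$1 - p3 * w'$2 = - (q1 * w$1 - p1 * w$2)"
proof -
  obtain b where b: "half_turn p2 q2 = mx p2 (- b) q2 (- p2)" "q2 * b = p2\<^sup>2 + 1"
    by (rule half_turn_props[OF dv])
  have D: "q3 = p2 * q1 - p1 * q2" "q1 = p3 * q2 - p2 * q3" and q2: "q2 > 0"
    using r by (auto simp: rational_triple_def markov_triple_def)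
  have "q2 * (p1 * p2 - b * q1) = - p2 * (p2 * q1 - p1 * q2) - q1 * (q2 * b - p2\<^sup>2)"
    by (simp add: algebra_simps power2_eq_square)
  also have "\<dots> = - p2 * q3 - q1" unfolding b(2) D(1)[symmetric] by simp
  also have "\<dots> = q2 * (- p3)" using D(2) by (simp add: algebra_simps)
  finally have 1: "p1 * p2 - b * q1 = - p3" using q2 by (metis mult_cancel_left less_irrefl)
  have "q2 * (p2 * p3 - b * q3) = p2 * (p3 * q2 - p2 * q3) - q3 * (q2 * b - p2\<^sup>2)"
    by (simp add: algebra_simps power2_eq_square)
  also have "\<dots> = p2 * q1 - q3" unfolding b(2) D(2)[symmetric] by simp
  also have "\<dots> = q2 * p1" using D(1) by (simp add: algebra_simps)
  finally have 2: "p2 * p3 - b * q3 = p1" using q2 by simp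
  have "q1 * w'$1 - p1 * w'$2 = (p2 * q1 - p1 * q2) * w$1 + (p1 * p2 - b * q1) * w$2"
    by (simp add: w'_def b algebra_simps)
  then show "q1 * w'$1 - p1 * w'$2 = q3 * w$1 - p3 * w$2" unfolding 1 D(1)[symmetric] by simp
  have "q3 * w'$1 - p3 * w'$2 = - (p3 * q2 - p2 * q3) * w$1 + (p2 * p3 - b * q3) * w$2"
    by (simp add: w'_def b algebra_simps)
  then show "q3 * w'$1 - p3 * w'$2 = - (q1 * w$1 - p1 * w$2)" unfolding 2 D(2)[symmetric] by simp
qed

lemma arc_forms_disjoint:
  assumes m: "p3 * q1 - p1 * q3 > 0" "q1 > 0" "q3 > 0" and jk: "j \<in> {1, 2, 3}" "k \<in> {1, 2, 3}" "j \<noteq> k"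
    and k: "arc_form p1 q1 p3 q3 k w \<ge> 0"
  shows "arc_form p1 q1 p3 q3 j w \<le> 0"
proof -
  define s L1 L3 m where "s = w$2" and "L1 = q1 * w$1 - p1 * w$2" and "L3 = q3 * w$1 - p3 * w$2"
    and "m = p3 * q1 - p1 * q3"
  have lin: "q3 * L1 = q1 * L3 + m * s" by (simp add: L1_def L3_def m_def s_def algebra_simps)
  have mq: "m > 0" "q1 > 0" "q3 > 0" using m by (simp_all add: m_def)
  have e1: "q3 * (s * L1) = q1 * (s * L3) + m * s\<^sup>2"
    using arg_cong[OF lin, of "\<lambda>x. s * x"] by (simp add: algebra_simps power2_eq_square)
  have e2: "q3 * L1\<^sup>2 = q1 * (L1 * L3) + m * (s * L1)"
    using arg_cong[OF lin, of "\<lambda>x. L1 * x"] by (simp add: algebra_simps power2_eq_square)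
  have e3: "q3 * (L1 * L3) = q1 * L3\<^sup>2 + m * (s * L3)"
    using arg_cong[OF lin, of "\<lambda>x. L3 * x"] by (simp add: algebra_simps power2_eq_square)
  have sq: "0 \<le> m * s\<^sup>2" "0 \<le> q3 * L1\<^sup>2" "0 \<le> q1 * L3\<^sup>2" using mq by simp_all
  have A: "s * L3 \<le> 0" if "s * L1 \<le> 0"
  proof -
    have "q3 * (s * L1) \<le> 0" using that mq by (simp add: mult_le_0_iff)
    then have "q1 * (s * L3) \<le> 0" using e1 sq by linarith
    then show ?thesis using mq by (simp add: mult_le_0_iff)
  qed
  have B: "0 \<le> L1 * L3" if "s * L1 \<le> 0"
  proof -
    have "m * (s * L1) \<le> 0" using that mq by (simp add: mult_le_0_iff)
    then have "0 \<le> q1 * (L1 * L3)" using e2 sq by linarith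
    then show ?thesis using mq by (simp add: zero_le_mult_iff)
  qed
  have C: "0 \<le> L1 * L3" if "s * L3 \<ge> 0"
  proof -
    have "0 \<le> m * (s * L3)" using that mq by simp
    then have "0 \<le> q3 * (L1 * L3)" using e3 sq by linarith
    then show ?thesis using mq by (simp add: zero_le_mult_iff)
  qed
  have D: "0 \<le> s * L1" if "L1 * L3 \<le> 0"
  proof -
    have "q1 * (L1 * L3) \<le> 0" using that mq by (simp add: mult_le_0_iff)
    then have "0 \<le> m * (s * L1)" using e2 sq by linarith
    then show ?thesis using mq by (simp add: zero_le_mult_iff)
  qed
  have E: "s * L3 \<le> 0" if "L1 * L3 \<le> 0"
  proof -
    have "q3 * (L1 * L3) \<le> 0" using that mq by (simp add: mult_le_0_iff)
    then have "m * (s * L3) \<le> 0" using e3 sq by linarith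
    then show ?thesis using mq by (simp add: mult_le_0_iff)
  qed
  have G: "0 \<le> s * L1" if "s * L3 \<ge> 0"
  proof -
    have "0 \<le> q1 * (s * L3)" using that mq by simp
    then have "0 \<le> q3 * (s * L1)" using e1 sq by linarith
    then show ?thesis using mq by (simp add: zero_le_mult_iff)
  qed
  have forms: "arc_form p1 q1 p3 q3 1 w = - (s * L1)" "arc_form p1 q1 p3 q3 2 w = - (L1 * L3)"
    "arc_form p1 q1 p3 q3 3 w = s * L3"
    by (simp_all add: arc_form_def side_def s_def L1_def L3_def)
  show ?thesis using jk k A B C D E G forms by (elim insertE emptyE; simp)
qed

text \<open>
  If an element preserves the pair of ideal endpoints of the geodesic, it fixes both, and is
  trivial, or exchanges them, and has trace zero.
\<close>

lemma comm_matrices_edge_stabilizer: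
  assumes A: "mx a b c d \<in> comm_matrices" and q: "q > 0"
    and z: "side p q a c = 0" "side p q (a * p + b * q) (c * p + d * q) = 0"
  shows "mx a b c d = mat 1 \<or> mx a b c d = - mat 1"
proof -
  have det: "a * d - b * c = 1" using A by (simp add: comm_matrices_def)
  have tr: "a + d \<noteq> 0" using comm_matrices_trace[OF A] by auto
  have 1: "c = 0 \<or> q * a = p * c" using z(1) by (auto simp: side_def)
  have 2: "c * p + d * q = 0 \<or> q * (a * p + b * q) = p * (c * p + d * q)"
    using z(2) by (auto simp: side_def)
  show ?thesis
  proof (cases "c = 0")
    case True
    then have ad: "a * d = 1" using det by simp
    then have d: "d = a" "a = 1 \<or> a = -1" by (auto simp: zmult_eq_1_iff)
    then have "q * (b * q) = 0" using 2 True q by (auto simp: algebra_simps)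
    then have "b = 0" using q by simp
    then show ?thesis using d True by (auto simp: mx_one)
  next
    case False
    with 1 have qa: "q * a = p * c" by simp
    from 2 show ?thesis
    proof
      assume "c * p + d * q = 0"
      then have "q * (a + d) = 0" using qa by (simp add: algebra_simps)
      then show ?thesis using q tr by simp
    next
      assume *: "q * (a * p + b * q) = p * (c * p + d * q)"
      have "q * (a * p) = p * (c * p)" using qa by (metis mult.commute mult.left_commute)
      with * have "q * (b * q) = p * (d * q)" unfolding distrib_left by linarith
      then have "q * (b * q) = (p * d) * q" by (simp add: algebra_simps)
      then have bq: "q * b = p * d" using q by (simp add: mult.commute)
      have "q * (a * d - b * c) = (q * a) * d - (q * b) * c" by (simp add: algebra_simps)
      also have "\<dots> = 0" unfolding qa bq by (simp add: algebra_simps)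
      finally show ?thesis using det q by simp
    qed
  qed
qed

text \<open>
  By ping-pong, a nontrivial element of the commutator subgroup carries both ideal endpoints of the
  geodesic into one closed arc, whose ends are vertices of the triangle. The image therefore lies
  weakly on one side of the geodesic and does not cross it; by the previous lemma it is not the
  geodesic itself.
\<close>

lemma markov_fraction_simple:
  assumes r: "rational_triple p1 q1 p2 q2 p3 q3"
  shows "simple_torus_geodesic (torus_proj \<circ> vertical_geodesic (of_int p1 / of_int q1))"
  unfolding simple_vertical_iff
proof (intro ballI allI impI)
  fix A s t
  assume A: "A \<in> comm_matrices" and eq: "moebius A (vertical_geodesic (of_int p1 / of_int q1) s)
      = vertical_geodesic (of_int p1 / of_int q1) t"
  have pos: "q1 > 0" "q2 > 0" "q3 > 0" using r by (auto simp: rational_triple_def markov_triple_def)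
  have m: "p3 * q1 - p1 * q3 > 0"
  proof -
    have "q2 * (3 * q1 * q3 - q2) = q1\<^sup>2 + q3\<^sup>2"
      using r by (simp add: rational_triple_def markov_triple_def algebra_simps power2_eq_square)
    also have "\<dots> > 0" using pos by (simp add: add_pos_pos)
    finally show ?thesis unfolding rational_triple_third[OF r] using pos by (simp add: zero_less_mult_iff)
  qed
  define g :: "nat \<Rightarrow> int^2^2" where
    "g k = (if k = 1 then half_turn p1 q1 else if k = 2 then half_turn p2 q2 else half_turn p3 q3)" for k
  define K :: "nat set" where "K = {1, 2, 3}"
  define F where "F = arc_form p1 q1 p3 q3"
  have gen: "generating {(p1, q1), (p2, q2), (p3, q3)}" by (rule rational_triple_generating[OF r])
  then have dv: "q1 dvd p1\<^sup>2 + 1" "q2 dvd p2\<^sup>2 + 1" "q3 dvd p3\<^sup>2 + 1" by (auto simp: generating_def)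
  obtain a b c d where Am: "A = mx a b c d" by (rule mx_cases)
  have det: "a * d - b * c = 1" using A Am by (simp add: comm_matrices_def)
  have "g ` K = turns {(p1, q1), (p2, q2), (p3, q3)}" by (simp add: g_def K_def turns_def insert_commute)
  moreover have "3 dvd chi A" using A dvd_trans[of 3 "6::int"] by (simp add: comm_matrices_def)
  ultimately have W: "A \<in> words (g ` K)" using gen A by (simp add: generating_def comm_matrices_def)
  have inv: "g k ** g k = - mat 1" for k using dv by (simp add: g_def half_turn_square)
  have swap: "F k (g k *v w) = - F k w" if kK: "k \<in> K" for k w
  proof -
    consider "k = 1" | "k = 2" | "k = 3" using kK unfolding K_def by blast
    then show ?thesis
    proof cases
      case 2
      then show ?thesis using half_turn_opposite[OF r dv(2), of w]
        by (simp add: F_def arc_form_def g_def, simp add: algebra_simps)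
    qed (simp_all add: F_def arc_form_def g_def half_turn_side dv)
  qed
  have disj: "F j w \<le> 0" if "j \<in> K" "k \<in> K" "j \<noteq> k" "F k w \<ge> 0" for j k w
    using arc_forms_disjoint[OF m pos(1,3)] that unfolding F_def K_def by blast
  have even: "F k (- w) = F k w" for k w
    by (simp add: F_def arc_form_def side_def algebra_simps)
  define e v :: "int^2" where "e = vector [1, 0]" and "v = vector [p1, q1]"
  have e: "F k e \<le> 0" if "k \<in> K" for k
    using that pos by (auto simp: F_def K_def arc_form_def side_def e_def)
  have v: "F k v \<le> 0" if "k \<in> K" for k
  proof -
    have "q3 * p1 - p3 * q1 \<le> 0" using m by (simp add: algebra_simps)
    then have "q1 * (q3 * p1 - p3 * q1) \<le> 0" using pos by (simp add: mult_le_0_iff)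
    then show ?thesis using that by (auto simp: F_def K_def arc_form_def side_def v_def)
  qed
  show "A = mat 1 \<or> A = - mat 1"
  proof (rule ccontr)
    assume nt: "\<not> (A = mat 1 \<or> A = - mat 1)"
    then obtain k where k: "reduced g K k A" using words_reduced[OF W inv] by blast
    have "F k (A *v e) \<ge> 0" "F k (A *v v) \<ge> 0"
      using ping_pong[OF k, of F] swap disj even e v by blast+
    then have "(F 1 (A *v e) \<ge> 0 \<and> F 1 (A *v v) \<ge> 0) \<or> (F 1 (A *v e) \<le> 0 \<and> F 1 (A *v v) \<le> 0)"
      using disj[of 1 k] reduced_in[OF k] by (cases "k = 1") (auto simp: K_def)
    moreover have "F 1 (A *v e) = - side p1 q1 a c"
      "F 1 (A *v v) = - side p1 q1 (a * p1 + b * q1) (c * p1 + d * q1)"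
      by (simp_all add: F_def arc_form_def Am e_def v_def)
    ultimately have signs:
      "(side p1 q1 a c \<le> 0 \<and> side p1 q1 (a * p1 + b * q1) (c * p1 + d * q1) \<le> 0) \<or>
       (side p1 q1 a c \<ge> 0 \<and> side p1 q1 (a * p1 + b * q1) (c * p1 + d * q1) \<ge> 0)" by auto
    define X Y Z where "X = real_of_int (side p1 q1 a c)"
      and "Y = real_of_int (side p1 q1 (a * p1 + b * q1) (c * p1 + d * q1))"
      and "Z = (of_int q1 * exp s)\<^sup>2"
    have "Y + Z * X = 0"
      using moebius_vertical_iff[OF pos(1) det] eq unfolding Am X_def Y_def Z_def by blast
    moreover have "Z > 0" using pos by (simp add: Z_def)
    moreover have "(X \<le> 0 \<and> Y \<le> 0) \<or> (X \<ge> 0 \<and> Y \<ge> 0)" using signs by (auto simp: X_def Y_def)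
    ultimately have "X = 0 \<and> Y = 0"
      by (smt (verit) mult_eq_0_iff mult_nonneg_nonneg mult_nonneg_nonpos)
    then have "side p1 q1 a c = 0" "side p1 q1 (a * p1 + b * q1) (c * p1 + d * q1) = 0"
      by (simp_all add: X_def Y_def)
    from comm_matrices_edge_stabilizer[OF A[unfolded Am] pos(1) this] nt show False by (simp add: Am)
  qed
qed

section \<open>Simple geodesics come from Markov fractions\<close>

text \<open>
  The quadratic form \<open>q\<^sup>2 - 3 m q k + k\<^sup>2\<close> has no nontrivial rational zeros: this says that the
  hyperbolic element of the next lemma has no rational fixed points.
\<close>

lemma no_rational_fixed_point:
  fixes q k m :: int
  assumes "q > 0" "k > 0" shows "q\<^sup>2 + k\<^sup>2 \<noteq> 3 * m * q * k"
proof
  assume eq: "q\<^sup>2 + k\<^sup>2 = 3 * m * q * k"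
  define g where "g = gcd q k"
  obtain a b where ab: "q = g * a" "k = g * b" "coprime a b"
    using assms gcd_coprime_exists[of q k] unfolding g_def by (metis gcd_eq_0_iff less_irrefl mult.commute)
  have g: "g \<noteq> 0" using assms by (simp add: g_def)
  have "g\<^sup>2 * (a\<^sup>2 + b\<^sup>2) = g\<^sup>2 * (3 * m * a * b)"
    using eq unfolding ab by (simp add: power2_eq_square algebra_simps)
  then have eq': "a\<^sup>2 + b\<^sup>2 = 3 * m * a * b" using g by simp
  have "b\<^sup>2 = a * (3 * m * b - a)" using eq' by (simp add: power2_eq_square algebra_simps)
  then have "a dvd b\<^sup>2" by simp
  then have "is_unit a" using ab(3) by (metis coprime_power_right_iff coprime_absorb_left zero_less_numeral)
  have "a\<^sup>2 = b * (3 * m * a - b)" using eq' by (simp add: power2_eq_square algebra_simps)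
  then have "b dvd a\<^sup>2" by simp
  then have "is_unit b" using ab(3) by (metis coprime_commute coprime_power_right_iff coprime_absorb_left zero_less_numeral)
  then have "\<bar>a\<bar> = 1" "\<bar>b\<bar> = 1" using \<open>is_unit a\<close> by simp_all
  then have "a\<^sup>2 = 1" "b\<^sup>2 = 1" by (metis power2_abs one_power2)+
  with eq' have "3 * (m * a * b) = 2" by simp
  then show False by presburger
qed

text \<open>
  Let \<open>x1 = p1 / q1\<close> and let \<open>h\<close> be the half-turn exchanging \<open>\<infinity>\<close> and \<open>x1\<close>, followed by
  the translation by \<open>3 e\<close>. It lies in the commutator subgroup. For \<open>e = 1\<close> its fixed points lie
  between \<open>x1\<close> and \<open>x1 + 3\<close>, and its inverse moves the points that lie in this interval, but not in the
  segment between the fixed points, to the right. The inverse also carries \<open>\<infinity>\<close> to \<open>x1\<close>. So if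
  \<open>x\<close> is one of these points, the image of the vertical geodesic of \<open>x\<close> starts to the left of
  \<open>x\<close>, ends to the right of it, and crosses it. The inequality says that \<open>x\<close> lies strictly between the fixed
  points. For \<open>e = -1\<close> the picture is reflected at \<open>x1\<close>.
\<close>

lemma simple_avoids_neighbourhood:
  assumes simple: "simple_torus_geodesic (torus_proj \<circ> vertical_geodesic (of_int p / of_int q))"
    and q: "q > 0" and q1: "q1 > 0" "q1 dvd p1\<^sup>2 + 1" and e: "e = 1 \<or> e = -1"
    and k: "k = e * (p * q1 - p1 * q)" "0 < k" "k < 3 * q * q1"
  shows "q\<^sup>2 < k * (3 * q * q1 - k)"
proof (rule ccontr)
  assume "\<not> q\<^sup>2 < k * (3 * q * q1 - k)"
  moreover have "q\<^sup>2 \<noteq> k * (3 * q * q1 - k)"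
    using no_rational_fixed_point[OF q k(2), of q1] by (simp add: power2_eq_square algebra_simps)
  ultimately have less: "k * (3 * q * q1 - k) < q\<^sup>2" by simp
  obtain b where b: "half_turn p1 q1 = mx p1 (- b) q1 (- p1)" "q1 * b = p1\<^sup>2 + 1"
    by (rule half_turn_props[OF q1(2)])
  \<comment> \<open>The inverse of \<open>h\<close>.\<close>
  define A where "A = mx (- p1) (b + 3 * e * p1) (- q1) (p1 + 3 * e * q1)"
  have ee: "e * e = 1" using e by auto
  have det: "- p1 * (p1 + 3 * e * q1) - (b + 3 * e * p1) * - q1 = 1"
    using b(2) by (simp add: algebra_simps power2_eq_square)
  have "A = - (half_turn p1 q1 ** Tpow (- 3 * e))" unfolding A_def b by (simp add: algebra_simps)
  moreover have "half_turn p1 q1 ** Tpow (- 3 * e) \<in> comm_matrices"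
  proof -
    have d: "det (half_turn p1 q1) = 1" by (rule det_half_turn[OF q1(2)])
    have "6 dvd 3 - 3 * e" using e by auto
    from dvd_add[OF dvd_add[OF chi_T[OF d, of "- 3 * e"] chi_half_turn[OF q1(2)]] this]
    have "6 dvd chi (half_turn p1 q1 ** Tpow (- 3 * e)) - 6 * e" by (simp add: algebra_simps)
    then have "6 dvd chi (half_turn p1 q1 ** Tpow (- 3 * e))" by (simp add: dvd_diff_left_iff)
    then show ?thesis using d by (simp add: comm_matrices_def det_mul)
  qed
  ultimately have A: "A \<in> comm_matrices" using comm_matrices_neg by simp
  define r s where "r = - p1 * p + (b + 3 * e * p1) * q" and "s = - q1 * p + (p1 + 3 * e * q1) * q"
  have "e * k = (e * e) * (p * q1 - p1 * q)" unfolding k(1) by (simp only: mult.assoc)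
  then have pk: "p * q1 - p1 * q = e * k" unfolding ee by simp
  have "s = 3 * e * q1 * q - (p * q1 - p1 * q)" by (simp add: s_def algebra_simps)
  then have s: "s = e * (3 * q1 * q - k)" unfolding pk by (simp add: algebra_simps)
  have "q1 * (q * r - p * s) = (p * q1 - p1 * q)\<^sup>2 + q\<^sup>2 * (q1 * b - p1\<^sup>2) - 3 * e * q * q1 * (p * q1 - p1 * q)"
    unfolding r_def s_def by (simp add: algebra_simps power2_eq_square)
  also have "\<dots> = (e * e) * k\<^sup>2 + q\<^sup>2 - (e * e) * (3 * q * q1 * k)"
    unfolding pk b(2) by (simp add: algebra_simps power2_eq_square)
  also have "\<dots> = q\<^sup>2 - k * (3 * q * q1 - k)"
    unfolding ee by (simp add: algebra_simps power2_eq_square)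
  finally have qr: "q1 * (q * r - p * s) = q\<^sup>2 - k * (3 * q * q1 - k)" .
  then have "0 < q1 * (q * r - p * s)" using less by simp
  then have L: "q * r - p * s > 0" using q1(1) by (simp add: zero_less_mult_iff)
  have u: "3 * q1 * q - k > 0" using k(3) by (simp add: algebra_simps)
  define X where "X = q1 * k"
  define Y where "Y = (3 * q1 * q - k) * (q * r - p * s)"
  have XY: "X > 0" "Y > 0" using q1(1) k(2) L u by (simp_all add: X_def Y_def)
  have "side p q (- p1) (- q1) = - q1 * (p * q1 - p1 * q)" by (simp add: side_def algebra_simps)
  then have sideX: "side p q (- p1) (- q1) = - e * X" unfolding pk X_def by simp
  have sideY: "side p q r s = e * Y" unfolding side_def Y_def s by (simp add: algebra_simps)
  \<comment> \<open>The time at which the geodesic meets its image.\<close>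
  define \<tau> where "\<tau> = ln (sqrt (of_int Y / of_int X) / of_int q)"
  have "of_int q * exp \<tau> = sqrt (of_int Y / of_int X)" using q XY by (simp add: \<tau>_def)
  then have "(of_int q * exp \<tau>)\<^sup>2 = of_int Y / real_of_int X" using XY by simp
  then have "of_int (side p q r s) + (of_int q * exp \<tau>)\<^sup>2 * of_int (side p q (- p1) (- q1)) = (0::real)"
    unfolding sideX sideY using XY by simp
  then have "\<exists>t. moebius A (vertical_geodesic (of_int p / of_int q) \<tau>) = vertical_geodesic (of_int p / of_int q) t"
    unfolding A_def moebius_vertical_iff[OF q det] r_def s_def .
  then have "A = mat 1 \<or> A = - mat 1" using simple A unfolding simple_vertical_iff by blast
  then show False using q1(1) by (auto simp: A_def mx_one)
qed

text \<open>
  Write \<open>t\<close> for the distance from \<open>x\<close> to the endpoint with denominator \<open>qa\<close>. The hypotheses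
  give \<open>t < qb / (qa qm)\<close>, and \<open>qa\<^sup>2 t (3 - t) > 1\<close>, hence \<open>\<ge> 1 + 1 / q\<^sup>2\<close> by integrality. On the
  other hand \<open>qa\<^sup>2 t (3 - t)\<close> takes the value \<open>1 + qa\<^sup>2 / qm\<^sup>2\<close> at \<open>t = qb / (qa qm)\<close> by the Markov
  equation, and is increasing up to there.
\<close>

lemma denominator_bound:
  fixes k q qa qb qm :: int
  assumes mt: "markov_triple qa qm qb" and ge: "qa * qb \<le> qm"
    and q: "q > 0" and k: "k > 0" "k * qm < q * qb" and s: "q\<^sup>2 < k * (3 * q * qa - k)"
  shows "qm \<le> q * qa" "qa < q"
proof -
  have pos: "qa > 0" "qm > 0" "qb > 0" and m: "qa\<^sup>2 + qm\<^sup>2 + qb\<^sup>2 = 3 * qa * qm * qb"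
    using mt by (auto simp: markov_triple_def)
  have "qa * qb \<le> k * qm" using ge k pos mult_mono[of 1 k "qa * qb" qm] by simp
  then have "qa * qb < q * qb" using k by linarith
  then show "qa < q" using pos by simp
  have "1 * qb \<le> qa * qb" using pos by (intro mult_right_mono) auto
  then have qb: "qb \<le> qm" using ge by linarith
  define S N where "S = k * qm" and "N = q * qb"
  have "q * qb \<le> q * qa * qm" using q pos qb mult_mono[of 1 qa qb qm] by (simp add: mult.assoc)
  then have "0 \<le> 3 * q * qa * qm - N - S"
    using k(2) mult_pos_pos[OF q pos(3)] unfolding N_def S_def by linarith
  then have "0 \<le> (N - S) * (3 * q * qa * qm - N - S)"
    using k(2) by (intro mult_nonneg_nonneg) (auto simp: N_def S_def)
  also have "(N - S) * (3 * q * qa * qm - N - S) = N * (3 * q * qa * qm - N) - S * (3 * q * qa * qm - S)"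
    by (simp add: algebra_simps)
  also have "N * (3 * q * qa * qm - N) = q\<^sup>2 * (3 * qa * qm * qb - qb\<^sup>2)"
    by (simp add: N_def algebra_simps power2_eq_square)
  also have "3 * qa * qm * qb - qb\<^sup>2 = qm\<^sup>2 + qa\<^sup>2" using m by simp
  also have "S * (3 * q * qa * qm - S) = qm\<^sup>2 * (k * (3 * q * qa - k))"
    by (simp add: S_def algebra_simps power2_eq_square)
  finally have "qm\<^sup>2 * (k * (3 * q * qa - k)) \<le> q\<^sup>2 * (qm\<^sup>2 + qa\<^sup>2)" by simp
  moreover have "qm\<^sup>2 * (q\<^sup>2 + 1) \<le> qm\<^sup>2 * (k * (3 * q * qa - k))" using s by (intro mult_left_mono) auto
  ultimately have "qm\<^sup>2 \<le> (q * qa)\<^sup>2" by (simp add: algebra_simps power_mult_distrib)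
  then show "qm \<le> q * qa" using mult_pos_pos[OF q pos(1)] by (intro power2_le_imp_le[of qm]) simp_all
qed

text \<open>
  Search in the tree of Markov fractions. Between the neighbours \<open>x1\<close> and \<open>x2\<close> of a triple lies the
  Markov fraction \<open>p' / q'\<close> obtained by flipping \<open>x3\<close>. If it is not \<open>x\<close>, then \<open>x\<close> lies in one
  of the two subintervals, which belong to the triples \<open>(x1, p' / q', x2)\<close> and
  \<open>(p' / q', x2, x1 + 3)\<close>. The denominators grow along the way, since \<open>q3 < 2 q1 q2\<close>
  persists and gives \<open>q' > q1 q2\<close>, but \<open>denominator_bound\<close> keeps their sum at most
  \<open>2 q\<^sup>2\<close>, so the search ends.
\<close>

lemma simple_between_is_markov:
  assumes simple: "simple_torus_geodesic (torus_proj \<circ> vertical_geodesic (of_int p / of_int q))"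
    and q: "q > 0" and "rational_triple p1 q1 p2 q2 p3 q3" and "q3 < 2 * q1 * q2"
    and "p * q1 - p1 * q > 0" and "p2 * q - p * q2 > 0"
  shows "markov_fraction (of_int p / of_int q)"
  using assms(3-)
proof (induction "nat (2 * q\<^sup>2 - q1 - q2)" arbitrary: p1 q1 p2 q2 p3 q3 rule: less_induct)
  case less
  note r = less.prems(1)
  define p' q' where "p' = 3 * q1 * p2 - p3" and "q' = 3 * q1 * q2 - q3"
  have r': "rational_triple p1 q1 p' q' p2 q2" unfolding p'_def q'_def by (rule rational_triple_flip_last[OF r])
  then have mt: "markov_triple q1 q' q2" and D1: "p' * q1 - p1 * q' = q2" and D2: "p2 * q' - p' * q2 = q1"
    by (auto simp: rational_triple_def)
  have pos: "q1 > 0" "q2 > 0" "q' > 0" using mt by (auto simp: markov_triple_def)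
  have big: "q1 * q2 < q'" using less.prems(2) by (simp add: q'_def)
  have "1 * q2 \<le> q1 * q2" "q1 * 1 \<le> q1 * q2" using pos by (auto intro: mult_right_mono mult_left_mono)
  then have lt: "q2 < q'" "q1 < q'" using big by auto
  have dv: "q1 dvd p1\<^sup>2 + 1" "q2 dvd p2\<^sup>2 + 1"
    using rational_triple_generating[OF r] by (auto simp: generating_def)
  define k1 k2 \<delta> where "k1 = p * q1 - p1 * q" and "k2 = p2 * q - p * q2" and "\<delta> = p' * q - p * q'"
  have k: "k1 > 0" "k2 > 0" using less.prems by (auto simp: k1_def k2_def)
  have e1: "k1 * q' + \<delta> * q1 = q * q2"
    unfolding D1[symmetric] k1_def \<delta>_def by (simp add: algebra_simps)
  have e2: "k2 * q' - \<delta> * q2 = q * q1"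
    unfolding D2[symmetric] k2_def \<delta>_def by (simp add: algebra_simps)
  have small: "ka < 3 * q * qa" if "ka > 0" "qa > 0" "qb > 0" "qa * qb < q'" "ka * q' < q * qb" for ka qa qb
  proof -
    have "ka * (qa * qb) \<le> ka * q'" using that by (intro mult_left_mono) auto
    then have "ka * qa * qb < q * qb" using that(5) by (simp add: mult.assoc)
    then have "ka * qa < q" using that(3) by simp
    moreover have "ka * 1 \<le> ka * qa" "q * 1 \<le> q * qa" using that q by (auto intro!: mult_left_mono)
    ultimately show ?thesis using q by linarith
  qed
  consider "\<delta> = 0" | "\<delta> > 0" | "\<delta> < 0" by linarith
  then show ?case
  proof cases
    case 1
    then have "real_of_int p / of_int q = of_int p' / of_int q'"
      using q pos by (simp add: \<delta>_def frac_eq_eq flip: of_int_mult)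
    then show ?thesis using rational_triple_shift[OF r'] unfolding markov_fraction_iff by blast
  next
    case 2
    have b: "k1 * q' < q * q2" using e1 mult_pos_pos[OF 2 pos(1)] by linarith
    have "q\<^sup>2 < k1 * (3 * q * q1 - k1)"
      using simple_avoids_neighbourhood[OF simple q pos(1) dv(1), of 1 k1] k small[OF k(1) pos(1,2) big b]
      by (simp add: k1_def)
    from denominator_bound[OF mt _ q k(1) b this] have bd: "q' \<le> q * q1" "q1 < q" using big by auto
    have "q * q1 \<le> q * (q - 1)" using bd q by (intro mult_left_mono) auto
    then have "q1 + q' \<le> 2 * q\<^sup>2" using bd q zero_le_square[of q] unfolding power2_eq_square right_diff_distrib by linarith
    then have "nat (2 * q\<^sup>2 - q1 - q') < nat (2 * q\<^sup>2 - q1 - q2)" using lt by simp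
    moreover have "q2 < 2 * q1 * q'"
    proof -
      have "1 * q' \<le> q1 * q'" using pos by (intro mult_right_mono) auto
      then show ?thesis using lt pos by linarith
    qed
    ultimately show ?thesis using less.hyps[OF _ r'] k(1) 2 unfolding k1_def \<delta>_def by simp
  next
    case 3
    have b: "k2 * q' < q * q1" using e2 mult_neg_pos[OF 3 pos(2)] by linarith
    have mt': "markov_triple q2 q' q1" using mt markov_commute by blast
    have big': "q2 * q1 < q'" using big by (simp add: mult.commute)
    have "q\<^sup>2 < k2 * (3 * q * q2 - k2)"
      using simple_avoids_neighbourhood[OF simple q pos(2) dv(2), of "-1" k2] k small[OF k(2) pos(2,1) big' b]
      by (simp add: k2_def)
    from denominator_bound[OF mt' _ q k(2) b this] have bd: "q' \<le> q * q2" "q2 < q" using big' by auto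
    have "q * q2 \<le> q * (q - 1)" using bd q by (intro mult_left_mono) auto
    then have "q' + q2 \<le> 2 * q\<^sup>2" using bd q zero_le_square[of q] unfolding power2_eq_square right_diff_distrib by linarith
    then have "nat (2 * q\<^sup>2 - q' - q2) < nat (2 * q\<^sup>2 - q1 - q2)" using lt by simp
    moreover have "q1 < 2 * q' * q2"
    proof -
      have "q' * 1 \<le> q' * q2" using pos by (intro mult_left_mono) auto
      then show ?thesis using lt pos by linarith
    qed
    moreover have "p * q' - p' * q > 0" using 3 by (simp add: \<delta>_def)
    ultimately show ?thesis using less.hyps[OF _ rational_triple_shift[OF r']] k(2) unfolding k2_def by simp
  qed
qed

lemma simple_rational_is_markov:
  assumes simple: "simple_torus_geodesic (torus_proj \<circ> vertical_geodesic x)" and x: "x \<in> \<rat>"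
  shows "markov_fraction x"
proof -
  obtain p q :: int where q: "q > 0" and x: "x = of_int p / of_int q"
    using Rats_cases'[OF x] by metis
  define n where "n = p div q"
  have n: "0 \<le> p - n * q" "p - n * q < q"
    using q by (simp_all add: n_def minus_div_mult_eq_mod)
  show ?thesis
  proof (cases "p = n * q")
    case True
    then have "x = of_int n / of_int 1" using q x by simp
    then show ?thesis using rational_triple_integers unfolding markov_fraction_iff by blast
  next
    case False
    then show ?thesis
      using simple_between_is_markov[OF simple[unfolded x] q rational_triple_integers[of n]] n unfolding x
      by (simp add: algebra_simps)
  qed
qed

theorem corollary4p3:
  fixes x :: real
  shows "markov_fraction x \<longleftrightarrow>
    simple_torus_geodesic (torus_proj \<circ> vertical_geodesic x) \<and>
    both_ends_in_cusp (torus_proj \<circ> vertical_geodesic x)"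
proof
  assume "markov_fraction x"
  then obtain p1 q1 p2 q2 p3 q3 where "rational_triple p1 q1 p2 q2 p3 q3" "x = of_int p1 / of_int q1"
    unfolding markov_fraction_iff by blast
  then show "simple_torus_geodesic (torus_proj \<circ> vertical_geodesic x) \<and>
    both_ends_in_cusp (torus_proj \<circ> vertical_geodesic x)"
    using markov_fraction_simple by (simp add: both_ends_in_cusp_vertical)
next
  assume "simple_torus_geodesic (torus_proj \<circ> vertical_geodesic x) \<and>
    both_ends_in_cusp (torus_proj \<circ> vertical_geodesic x)"
  then show "markov_fraction x"
    using simple_rational_is_markov by (simp add: both_ends_in_cusp_vertical)
qed

end
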